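(* Let $K$ be a local field of characteristic $p$, let $\psi$ be a Drinfeld $A$-module of good reduction over $\mathcal O_K$, and let $\bar\phi$ be its reduction modulo $\mathfrak m_K$, viewed again as a Drinfeld module over $\mathcal O_K$ via $k\hookrightarrow\mathcal O_K$. Let $x=\sum_{j\le0}x_j\tau^j$ be the unique series with all $x_j\in\mathcal O_K$ and $x\equiv1$ modulo $\mathfrak m_K$ satisfying $\psi_ax=x\bar\phi_a$ for all $a\in A$, and let $x^{-1}=\sum_{j\le0}y_j\tau^j\in\mathcal O_{K^{\rm perf}}[[\tau^{-1}]]$ be its inverse. There are natural $A$-module isomorphisms $$\chi:(K^{\rm alg}/\mathfrak m_{K^{\rm alg}},\bar\phi)\to(K^{\rm alg}/\mathfrak m_{K^{\rm alg}},\psi),$$ $$\chi:(K^{\rm perf}/\mathfrak m_{K^{\rm perf}},\bar\phi)\to(K^{\rm perf}/\mathfrak m_{K^{\rm perf}},\psi),$$ $$\chi:(\mathcal P_{K^{\rm perf}},\bar\phi)\to(\mathcal P_{K^{\rm perf}},\psi),$$ which on any residue class $[\xi]$ are given by the formulas $$\chi([\xi])=\sum_{j\le0}\bigl[x_j\xi^{p^j}\bigr]\qquad\text{and}\qquad\chi^{-1}([\xi])=\sum_{j\le0}\bigl[y_j\xi^{p^j}\bigr].$$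
   Context: $K$ is a local field of characteristic $p$ with finite residue field $k$ and normalized valuation $v$, extended to a fixed algebraic closure $K^{\rm alg}$; $K^{\rm perf}\subset K^{\rm alg}$ is the perfection of $K$. For an intermediate field $K'$ of $K^{\rm alg}/K$, $\mathcal O_{K'}$ and $\mathfrak m_{K'}$ denote its valuation ring and maximal ideal. There is a unique ring section $k\hookrightarrow\mathcal O_K$ of $\mathcal O_K\to k$. $\mathcal P_{K^{\rm perf}}:=K^{\rm perf}/\mathcal O_{K^{\rm perf}}$. For a perfect commutative $\mathbb F_p$-algebra $S$, $S((\tau^{-1}))$ is the ring of formal Laurent series $\sum_{i}x_i\tau^i$ with $x_i\in S$, $x_i=0$ for $i\gg0$, with multiplication determined by $\tau^ix=x^{p^i}\tau^i$; it contains the twisted polynomial ring $S[\tau]$ and the subring $S[[\tau^{-1}]]$ of series with $x_i=0$ for $i>0$. The condition $x\equiv1$ modulo $\mathfrak m_K$ means $x_0-1\in\mathfrak m_K$ and $x_j\in\mathfrak m_K$ for $j<0$. It is known that the $x$ in the claim exists and is unique, that it has a two-sided inverse in $\mathcal O_{K^{\rm perf}}[[\tau^{-1}]]$, and that there is a number $w>0$ with $v(x_j-\delta_{j,0})\ge w$ and $v(y_j-\delta_{j,0})\ge w$ for all $j\le0$; the sums in the formulas have only finitely many nonzero terms. $A$ is an admissible coefficient ring for Drinfeld modules: the ring of elements of a global function field of characteristic $p$ that are regular outside a fixed place $\infty$. A Drinfeld $A$-module $\psi$ of good reduction over $\mathcal O_K$ is a ring homomorphism $A\to\mathcal O_K[\tau]$,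 $a\mapsto\psi_a$, of positive rank, such that for every $a\ne0$ the highest coefficient of $\psi_a$ is a unit in $\mathcal O_K$. Its reduction $\bar\phi:A\to k[\tau]$ is a Drinfeld $A$-module over $k$. A polynomial $f=\sum f_i\tau^i\in \mathcal O_K[\tau]$ acts on $\mathcal O_K$-algebras by $f(\xi)=\sum f_i\xi^{p^i}$; $(H,\psi)$ denotes $H$ with $A$ acting through $a\mapsto\psi_a$, also for the induced action on quotients. *)

theory Defs
  imports
    "HOL-Library.Extended_Real"
    "HOL-Algebra.Algebraic_Closure_Type"
    "HOL-Algebra.Generated_Fields"
    "HOL-Algebra.Module"
begin

text \<open>The fields \<open>K \<subseteq> K^perf \<subseteq> K^alg\<close> are subsets of a type, which plays the role of \<open>K^alg\<close>;
  rings and modules in the sense of \<open>HOL-Algebra\<close> are cut out of it by their carriers.\<close>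

abbreviation subset_ring :: "'a::field set \<Rightarrow> 'a ring" where
  "subset_ring S \<equiv> ring_of_type_algebra\<lparr>carrier := S\<rparr>"

section \<open>Valuations and local fields\<close>

definition valuation :: "('a::field \<Rightarrow> ereal) \<Rightarrow> bool" where
  "valuation v \<longleftrightarrow>
     (\<forall>a. v a = \<infinity> \<longleftrightarrow> a = 0) \<and> (\<forall>a. v a \<noteq> -\<infinity>) \<and>
     (\<forall>a b. v (a * b) = v a + v b) \<and> (\<forall>a b. v (a + b) \<ge> min (v a) (v b))"

definition normalized_on :: "'a::field set \<Rightarrow> ('a \<Rightarrow> ereal) \<Rightarrow> bool" where
  "normalized_on S v \<longleftrightarrow> v ` (S - {0}) = range (\<lambda>n::int. ereal (of_int n))"

definition complete_on :: "'a::field set \<Rightarrow> ('a \<Rightarrow> ereal) \<Rightarrow> bool" where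
  "complete_on S v \<longleftrightarrow>
     (\<forall>u::nat \<Rightarrow> 'a.
        (\<forall>n. u n \<in> S) \<and> (\<forall>B::real. \<exists>N. \<forall>m\<ge>N. \<forall>n\<ge>N. v (u m - u n) > ereal B) \<longrightarrow>
        (\<exists>L\<in>S. \<forall>B::real. \<exists>N. \<forall>n\<ge>N. v (u n - L) > ereal B))"

definition val_ring :: "('a::field \<Rightarrow> ereal) \<Rightarrow> 'a set \<Rightarrow> 'a set" where
  "val_ring v S = {z \<in> S. v z \<ge> 0}"

definition max_ideal :: "('a::field \<Rightarrow> ereal) \<Rightarrow> 'a set \<Rightarrow> 'a set" where
  "max_ideal v S = {z \<in> S. v z > 0}"

definition residue_field :: "('a::field \<Rightarrow> ereal) \<Rightarrow> 'a set \<Rightarrow> 'a set ring" where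
  "residue_field v S = subset_ring (val_ring v S) Quot max_ideal v S"

text \<open>\<open>K\<close> is a local field of characteristic \<open>p\<close>, the ambient type is an algebraic closure of \<open>K\<close>,
  and \<open>v\<close> is the extension to it of the normalized valuation of \<open>K\<close>.\<close>

definition local_field_with_closure :: "nat \<Rightarrow> 'a::field set \<Rightarrow> ('a \<Rightarrow> ereal) \<Rightarrow> bool" where
  "local_field_with_closure p K v \<longleftrightarrow>
     prime p \<and> CHAR('a) = p \<and>
     algebraic_closure (ring_of_type_algebra :: 'a ring) K \<and>
     valuation v \<and> normalized_on K v \<and> complete_on K v \<and>
     finite (carrier (residue_field v K))"

definition perfection :: "nat \<Rightarrow> 'a::field set \<Rightarrow> 'a set" where
  "perfection p K = {z. \<exists>n. z ^ (p ^ n) \<in> K}"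

text \<open>The residue classes are the elements of the residue field, so \<open>s c \<in> c\<close> says that
  \<open>s\<close> is a section of the reduction map.\<close>

definition ring_section :: "('a::field \<Rightarrow> ereal) \<Rightarrow> 'a set \<Rightarrow> ('a set \<Rightarrow> 'a) \<Rightarrow> bool" where
  "ring_section v K s \<longleftrightarrow>
     s \<in> ring_hom (residue_field v K) (subset_ring (val_ring v K)) \<and>
     (\<forall>c \<in> carrier (residue_field v K). s c \<in> c)"

section \<open>Twisted Laurent series in \<open>\<tau>\<^sup>-\<^sup>1\<close>\<close>

text \<open>\<open>frob p j z\<close> is \<open>z ^ (p ^ j)\<close>; for \<open>j < 0\<close> this is the unique \<open>p ^ (- j)\<close>-th root of \<open>z\<close>
  in the perfect ambient field.\<close>

definition frob :: "nat \<Rightarrow> int \<Rightarrow> 'a::field \<Rightarrow> 'a" where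
  "frob p j z = (if j \<ge> 0 then z ^ (p ^ nat j) else (THE u. u ^ (p ^ nat (- j)) = z))"

text \<open>A series \<open>\<Sum>i. f i \<tau>^i\<close> is its coefficient function. From \<open>\<tau>^i z = z^(p^i) \<tau>^i\<close> the coefficient of
  \<open>\<tau>^n\<close> in a product is \<open>\<Sum>i. f i * (g (n - i))^(p^i)\<close>, a finite sum as the supports are
  bounded above.\<close>

definition twisted_mult :: "nat \<Rightarrow> (int \<Rightarrow> 'a::field) \<Rightarrow> (int \<Rightarrow> 'a) \<Rightarrow> int \<Rightarrow> 'a" where
  "twisted_mult p f g = (\<lambda>n. \<Sum>i | f i \<noteq> 0 \<and> g (n - i) \<noteq> 0. f i * frob p i (g (n - i)))"

definition twisted_laurent :: "nat \<Rightarrow> 'a::field set \<Rightarrow> (int \<Rightarrow> 'a) ring" where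
  "twisted_laurent p S =
     \<lparr>carrier = {f. (\<forall>i. f i \<in> S) \<and> (\<exists>N. \<forall>i>N. f i = 0)},
      monoid.mult = twisted_mult p,
      one = (\<lambda>i. if i = 0 then 1 else 0),
      ring.zero = (\<lambda>i. 0),
      add = (\<lambda>f g i. f i + g i)\<rparr>"

definition twisted_power_series :: "nat \<Rightarrow> 'a::field set \<Rightarrow> (int \<Rightarrow> 'a) ring" where
  "twisted_power_series p S =
     (twisted_laurent p S)\<lparr>carrier := {f. (\<forall>i. f i \<in> S) \<and> (\<forall>i>0. f i = 0)}\<rparr>"

definition twisted_poly :: "nat \<Rightarrow> 'a::field set \<Rightarrow> (int \<Rightarrow> 'a) ring" where
  "twisted_poly p S =
     (twisted_laurent p S)\<lparr>carrier :=
        {f. (\<forall>i. f i \<in> S) \<and> (\<forall>i<0. f i = 0) \<and> (\<exists>N. \<forall>i>N. f i = 0)}\<rparr>"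

definition tau_degree :: "(int \<Rightarrow> 'a::field) \<Rightarrow> int" where
  "tau_degree f = Max {i. f i \<noteq> 0}"

text \<open>For \<open>f = 0\<close> this is \<open>0\<close>, whatever the value of \<open>tau_degree 0\<close>.\<close>

definition tau_lead :: "(int \<Rightarrow> 'a::field) \<Rightarrow> 'a" where
  "tau_lead f = f (tau_degree f)"

definition tau_apply :: "nat \<Rightarrow> (int \<Rightarrow> 'a::field) \<Rightarrow> 'a \<Rightarrow> 'a" where
  "tau_apply p f \<xi> = (\<Sum>i | f i \<noteq> 0. f i * frob p i \<xi>)"

section \<open>Coefficient rings and Drinfeld modules\<close>

text \<open>\<open>generate_field F {}\<close> is the prime field; a global function field of characteristic \<open>p\<close>
  is a finite extension of some \<open>\<F>\<^sub>p(t)\<close> with \<open>t\<close> transcendental over \<open>\<F>\<^sub>p\<close>.\<close>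

definition global_function_field :: "nat \<Rightarrow> 'f::field itself \<Rightarrow> bool" where
  "global_function_field p (_ :: 'f itself) \<longleftrightarrow>
     (let F = (ring_of_type_algebra :: 'f ring) in
        prime p \<and> CHAR('f) = p \<and>
        (\<exists>t. (ring.transcendental F over generate_field F {}) t \<and>
             ring.finite_dimension F (generate_field F {t}) (carrier F)))"

text \<open>Places are represented by their normalized valuations.\<close>

definition place :: "('f::field \<Rightarrow> ereal) \<Rightarrow> bool" where
  "place w \<longleftrightarrow> valuation w \<and> normalized_on UNIV w"

definition regular_outside :: "('f::field \<Rightarrow> ereal) \<Rightarrow> 'f ring" where
  "regular_outside winf = subset_ring {a. \<forall>w. place w \<and> w \<noteq> winf \<longrightarrow> w a \<ge> 0}"

text \<open>The rank \<open>r\<close> is determined by \<open>deg\<^sub>\<tau> \<psi>\<^sub>a = r * deg a\<close> with \<open>p ^ deg a = |A / (a)|\<close>.\<close>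

definition has_rank :: "nat \<Rightarrow> 'f::field ring \<Rightarrow> ('f \<Rightarrow> int \<Rightarrow> 'a::field) \<Rightarrow> nat \<Rightarrow> bool" where
  "has_rank p A \<psi> r \<longleftrightarrow>
     (\<forall>a \<in> carrier A - {0}. p ^ nat (tau_degree (\<psi> a)) = card (carrier (A Quot PIdl\<^bsub>A\<^esub> a)) ^ r)"

definition good_reduction_drinfeld ::
    "nat \<Rightarrow> 'f::field ring \<Rightarrow> 'a::field set \<Rightarrow> ('f \<Rightarrow> int \<Rightarrow> 'a) \<Rightarrow> bool" where
  "good_reduction_drinfeld p A \<O> \<psi> \<longleftrightarrow>
     \<psi> \<in> ring_hom A (twisted_poly p \<O>) \<and>
     (\<exists>r>0. has_rank p A \<psi> r) \<and>
     (\<forall>a \<in> carrier A - {0}. tau_lead (\<psi> a) \<in> Units (subset_ring \<O>))"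

text \<open>The reduction modulo \<open>\<mm>\<^sub>K\<close>, with coefficients mapped back to \<open>\<O>\<^sub>K\<close> by the section \<open>s\<close>.\<close>

definition reduction ::
    "('a::field \<Rightarrow> ereal) \<Rightarrow> 'a set \<Rightarrow> ('a set \<Rightarrow> 'a) \<Rightarrow> ('f \<Rightarrow> int \<Rightarrow> 'a) \<Rightarrow> 'f \<Rightarrow> int \<Rightarrow> 'a" where
  "reduction v K s \<psi> = (\<lambda>a i. s (max_ideal v K +>\<^bsub>subset_ring (val_ring v K)\<^esub> \<psi> a i))"

section \<open>The \<open>A\<close>-modules \<open>(H/N, \<psi>)\<close>\<close>

abbreviation residue_class :: "'a::field set \<Rightarrow> 'a set \<Rightarrow> 'a \<Rightarrow> 'a set" where
  "residue_class H N \<xi> \<equiv> N +>\<^bsub>subset_ring H\<^esub> \<xi>"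

text \<open>The record type of modules extends that of rings; the components \<open>mult\<close> and \<open>one\<close> play no
  role in a module. The union in \<open>smult\<close> is the single class \<open>[\<psi>\<^sub>a(\<xi>)]\<close>, for any \<open>\<xi>\<close> in the class,
  as soon as the action descends to the quotient.\<close>

definition quotient_module ::
    "nat \<Rightarrow> 'a::field set \<Rightarrow> 'a set \<Rightarrow> ('f \<Rightarrow> int \<Rightarrow> 'a) \<Rightarrow> ('f, 'a set) module" where
  "quotient_module p H N \<psi> =
     \<lparr>carrier = a_rcosets\<^bsub>subset_ring H\<^esub> N,
      monoid.mult = undefined, one = undefined,
      ring.zero = N,
      add = set_add (subset_ring H),
      module.smult = (\<lambda>a C. \<Union>\<xi>\<in>C. residue_class H N (tau_apply p (\<psi> a) \<xi>))\<rparr>"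

definition module_iso ::
    "'f ring \<Rightarrow> ('f, 'b) module \<Rightarrow> ('f, 'c) module \<Rightarrow> ('b \<Rightarrow> 'c) \<Rightarrow> bool" where
  "module_iso A M M' h \<longleftrightarrow>
     Module.module A M \<and> Module.module A M' \<and>
     h \<in> iso (add_monoid M) (add_monoid M') \<and>
     (\<forall>a \<in> carrier A. \<forall>c \<in> carrier M. h (a \<odot>\<^bsub>M\<^esub> c) = a \<odot>\<^bsub>M'\<^esub> h c)"

text \<open>\<open>h [\<xi>] = \<Sum>j\<le>0. [z j * \<xi>^(p^j)]\<close> in the module \<open>M\<close> with underlying group \<open>H/N\<close>, including the
  assertion that only finitely many terms are nonzero (\<open>finsum\<close> over an infinite index set
  carries no information).\<close>

definition given_by_series ::
    "nat \<Rightarrow> 'a::field set \<Rightarrow> 'a set \<Rightarrow> ('f, 'a set) module \<Rightarrow> (int \<Rightarrow> 'a) \<Rightarrow>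
     ('a set \<Rightarrow> 'a set) \<Rightarrow> bool" where
  "given_by_series p H N M z h \<longleftrightarrow>
     (\<forall>\<xi>\<in>H.
        let c = (\<lambda>j. residue_class H N (z j * frob p j \<xi>));
            J = {j. j \<le> 0 \<and> c j \<noteq> \<zero>\<^bsub>M\<^esub>}
        in finite J \<and> h (residue_class H N \<xi>) = finsum M c J)"

definition series_module_iso ::
    "nat \<Rightarrow> 'f ring \<Rightarrow> 'a::field set \<Rightarrow> 'a set \<Rightarrow> ('f \<Rightarrow> int \<Rightarrow> 'a) \<Rightarrow> ('f \<Rightarrow> int \<Rightarrow> 'a) \<Rightarrow>
     (int \<Rightarrow> 'a) \<Rightarrow> (int \<Rightarrow> 'a) \<Rightarrow> ('a set \<Rightarrow> 'a set) \<Rightarrow> bool" where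
  "series_module_iso p A H N \<phi> \<psi> x y \<chi> \<longleftrightarrow>
     (let M\<^sub>\<phi> = quotient_module p H N \<phi>; M\<^sub>\<psi> = quotient_module p H N \<psi> in
        module_iso A M\<^sub>\<phi> M\<^sub>\<psi> \<chi> \<and>
        given_by_series p H N M\<^sub>\<psi> x \<chi> \<and>
        given_by_series p H N M\<^sub>\<phi> y (inv_into (carrier M\<^sub>\<phi>) \<chi>))"

end

theory Submission
  imports Defs
begin

text \<open>
  Let \<open>H\<close> be \<open>K^alg\<close> or \<open>K^perf\<close> and let \<open>N\<close> be its maximal ideal or its valuation ring. Call a
  twisted Laurent series in \<open>\<tau>\<^sup>-\<^sup>1\<close> over \<open>\<O>\<^sub>H\<close> contracting if its coefficients of negative degree have
  valuation at least some fixed \<open>w > 0\<close>. For \<open>\<xi> \<noteq> 0\<close> and \<open>j \<rightarrow> -\<infinity>\<close> the valuation of \<open>\<xi>^(p^j)\<close> tends to \<open>0\<close>, so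
  almost all terms \<open>f j * \<xi>^(p^j)\<close> of a contracting series lie in \<open>N\<close> (\<open>finite_nonzero_terms\<close>), and
  \<open>f\<close> acts on \<open>H/N\<close> by \<open>[\<xi>] \<mapsto> \<Sum>j. [f j * \<xi>^(p^j)]\<close>. This action is additive, and rearranging
  a double sum with finitely many nonzero terms shows that the product of series acts by composition
  (\<open>series_value_mult\<close>).

  The integral polynomials \<open>\<psi>_a\<close> and \<open>\<phi>_a\<close> are contracting; so is \<open>x\<close>, because \<open>v\<close> is discrete
  on \<open>K\<close>; and so is its inverse \<open>y\<close>, by comparing coefficients in \<open>x y = 1\<close>
  (\<open>inverse_coeff_bound\<close>). The claim is now formal (\<open>series_module_iso_action\<close>): \<open>x y = y x = 1\<close>
  says that the actions of \<open>x\<close> and \<open>y\<close> are inverse to each other, and \<open>\<psi>_a x = x \<phi>_a\<close> says that the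
  action of \<open>x\<close> is \<open>A\<close>-linear from \<open>\<phi>\<close> to \<open>\<psi>\<close>. That the quotients are modules rests on \<open>\<phi>\<close> being a ring
  homomorphism, like \<open>\<psi>\<close>: reduction followed by the section is an endomorphism of the ring \<open>\<O>\<^sub>K\<close>,
  and ring homomorphisms commute with the Frobenius (\<open>reduction_ring_hom\<close>).
\<close>

section \<open>Valuations\<close>

lemma valuation_zero: "valuation v \<Longrightarrow> v 0 = \<infinity>"
  by (simp add: valuation_def)

lemma valuation_mult: "valuation v \<Longrightarrow> v (a * b) = v a + v b"
  by (simp add: valuation_def)

lemma valuation_finite:
  assumes "valuation v" "a \<noteq> 0"
  obtains r where "v a = ereal r"
  using assms by (cases "v a") (auto simp: valuation_def)

lemma valuation_one:
  assumes v: "valuation v"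
  shows "v 1 = 0"
proof -
  obtain r where r: "v 1 = ereal r"
    using valuation_finite[OF v, of 1] by auto
  show ?thesis
    using valuation_mult[OF v, of 1 1] r by (simp add: zero_ereal_def)
qed

lemma valuation_uminus:
  assumes v: "valuation v"
  shows "v (- a) = v a"
proof -
  obtain r where r: "v (-1) = ereal r"
    using valuation_finite[OF v, of "-1"] by auto
  have "v (-1) = 0"
    using valuation_mult[OF v, of "-1" "-1"] r valuation_one[OF v] by (simp add: zero_ereal_def)
  thus ?thesis
    using valuation_mult[OF v, of "-1" a] by simp
qed

lemma valuation_power:
  assumes v: "valuation v"
  shows "n > 0 \<Longrightarrow> v (a ^ n) = ereal (real n) * v a"
proof (induction n rule: nat_induct_non_zero)
  case (Suc n)
  have "v (a ^ Suc n) = v a + ereal (real n) * v a"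
    using Suc valuation_mult[OF v] by simp
  also have "\<dots> = ereal (real (Suc n)) * v a"
  proof (cases "v a")
    case (real r)
    then show ?thesis by (simp add: algebra_simps)
  next
    case PInf
    then show ?thesis using Suc by simp
  next
    case MInf
    then show ?thesis using v by (simp add: valuation_def)
  qed
  finally show ?case .
qed (simp add: one_ereal_def[symmetric])

lemma valuation_add_ge:
  assumes "valuation v" "v a \<ge> c" "v b \<ge> c"
  shows "v (a + b) \<ge> c"
  using assms by (meson min.boundedI order_trans valuation_def)

lemma valuation_add_gt:
  assumes "valuation v" "v a > c" "v b > c"
  shows "v (a + b) > c"
  using assms unfolding valuation_def by (metis less_le_trans min_less_iff_conj)

lemma valuation_sum_ge:
  assumes v: "valuation v" and "\<And>i. i \<in> I \<Longrightarrow> v (f i) \<ge> c"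
  shows "v (\<Sum>i\<in>I. f i) \<ge> c"
  using assms(2)
  by (induction I rule: infinite_finite_induct)
     (auto simp: valuation_zero[OF v] intro: valuation_add_ge[OF v])

section \<open>The Frobenius in a perfect field\<close>

lemma prime_power_char_inj:
  fixes a b :: "'a::field"
  assumes "prime CHAR('a)" and "a ^ (CHAR('a) ^ n) = b ^ (CHAR('a) ^ n)"
  shows "a = b"
proof -
  have "a ^ (CHAR('a) ^ n) = (a - b) ^ (CHAR('a) ^ n) + b ^ (CHAR('a) ^ n)"
    using freshmans_dream'[OF assms(1), of _ n "a - b" b] by simp
  hence "(a - b) ^ (CHAR('a) ^ n) = 0"
    using assms(2) by simp
  thus ?thesis by simp
qed

locale perfect_valued_field =
  fixes p :: nat and v :: "'a::field \<Rightarrow> ereal"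
  assumes prime_p: "prime p" and char_p: "CHAR('a) = p"
    and ex_root: "\<exists>u. u ^ p = (z::'a)" and val: "valuation v"
begin

lemma p_gt_1: "p > 1" and p_pos: "p > 0"
  using prime_p prime_gt_1_nat prime_gt_0_nat by auto

lemma power_inj: "a ^ (p ^ n) = b ^ (p ^ n) \<Longrightarrow> a = b" for a b :: 'a
  using prime_power_char_inj[of a n b] prime_p char_p by simp

lemma ex_power_root: "\<exists>u. u ^ (p ^ n) = (z::'a)"
proof (induction n arbitrary: z)
  case (Suc n)
  obtain u where u: "u ^ p = z" using ex_root by blast
  obtain u' where "u' ^ (p ^ n) = u" using Suc by blast
  with u have "u' ^ (p ^ Suc n) = z"
    by (simp add: power_mult mult.commute[of p])
  thus ?case by blast
qed auto

text \<open>Raising to a high power of \<open>p\<close> turns every statement about \<open>frob\<close> into one about ordinary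
  powers, and loses nothing because the Frobenius is injective.\<close>

lemma frob_power:
  assumes "int m + j \<ge> 0"
  shows "frob p j z ^ (p ^ m) = (z::'a) ^ (p ^ nat (int m + j))"
proof (cases "j \<ge> 0")
  case True
  thus ?thesis
    by (simp add: frob_def nat_add_distrib power_add flip: power_mult) (simp add: mult.commute)
next
  case False
  have "\<exists>!u. u ^ (p ^ nat (- j)) = z"
    using ex_power_root power_inj by metis
  hence "frob p j z ^ (p ^ nat (- j)) = z"
    unfolding frob_def using False theI'[of "\<lambda>u. u ^ (p ^ nat (- j)) = z"] by simp
  moreover have "m = nat (- j) + nat (int m + j)"
    using False assms by simp
  ultimately show ?thesis
    by (metis power_add power_mult)
qed

lemma frob_eqI:
  assumes "int m + j \<ge> 0" "u ^ (p ^ m) = z ^ (p ^ nat (int m + j))"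
  shows "u = frob p j (z::'a)"
  using power_inj frob_power assms by metis

lemma frob_add: "frob p j (a + b) = frob p j a + frob p j (b::'a)"
proof (rule frob_eqI[symmetric])
  show "0 \<le> int (nat (- j)) + j" by simp
  then show "(frob p j a + frob p j b) ^ p ^ nat (- j) =
    (a + b) ^ p ^ nat (int (nat (- j)) + j)"
    using freshmans_dream'[where 'a = 'a] prime_p char_p by (simp add: frob_power)
qed

lemma frob_mult: "frob p j (a * b) = frob p j a * frob p j (b::'a)"
  by (rule frob_eqI[of "nat (- j)", symmetric]) (simp_all add: power_mult_distrib frob_power)

lemma frob_0 [simp]: "frob p j 0 = (0::'a)"
  by (rule frob_eqI[of "nat (- j)", symmetric]) (simp_all add: power_0_left p_pos)

lemma frob_index_0 [simp]: "frob p 0 z = z"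
  by (simp add: frob_def)

lemma frob_diff: "frob p j (a - b) = frob p j a - frob p j (b::'a)"
  using frob_add[of j "a - b" b] by simp

lemma frob_sum: "frob p j (\<Sum>i\<in>I. f i) = (\<Sum>i\<in>I. frob p j (f i :: 'a))"
  by (induction I rule: infinite_finite_induct) (auto simp: frob_add)

lemma frob_frob: "frob p i (frob p j z) = frob p (i + j) (z::'a)"
proof (rule frob_eqI)
  define m where "m = nat (- i) + nat (- j)"
  show "int m + (i + j) \<ge> 0" by (simp add: m_def)
  have *: "int m + i \<ge> 0" by (simp add: m_def)
  have "frob p i (frob p j z) ^ p ^ m = frob p j z ^ p ^ nat (int m + i)"
    using * by (rule frob_power)
  also have "\<dots> = z ^ p ^ nat (int (nat (int m + i)) + j)"
    by (rule frob_power) (simp add: m_def)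
  finally show "frob p i (frob p j z) ^ p ^ m = z ^ p ^ nat (int m + (i + j))"
    using * by (simp add: add.assoc)
qed

lemma valuation_frob: "v (frob p j z) = ereal (real p powi j) * v z"
proof (cases "z = 0")
  case True
  thus ?thesis using valuation_zero[OF val] p_pos by simp
next
  case False
  define m where "m = nat (- j)"
  have eq: "frob p j z ^ (p ^ m) = z ^ (p ^ nat (int m + j))"
    by (rule frob_power) (simp add: m_def)
  with False have "frob p j z \<noteq> 0"
    by (metis p_pos power_eq_0_iff zero_less_power)
  then obtain r r' where r: "v (frob p j z) = ereal r" "v z = ereal r'"
    using False valuation_finite[OF val] by metis
  from eq have "real (p ^ m) * r = real (p ^ nat (int m + j)) * r'"
    using valuation_power[OF val, of "p ^ m" "frob p j z"]
      valuation_power[OF val, of "p ^ nat (int m + j)" z] r p_pos by simp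
  moreover have "real (p ^ nat (int m + j)) = real p ^ m * real p powi j"
    using p_pos by (cases "j \<ge> 0") (simp_all add: m_def power_int_def power_inverse)
  ultimately have "r = real p powi j * r'"
    using p_pos by simp
  thus ?thesis using r by simp
qed

lemma valuation_frob_ge_0: "v z \<ge> 0 \<Longrightarrow> v (frob p j z) \<ge> 0"
  and valuation_frob_gt_0: "v z > 0 \<Longrightarrow> v (frob p j z) > 0"
  using p_pos by (simp_all add: valuation_frob ereal_zero_less_0_iff)

text \<open>As \<open>j\<close> tends to \<open>-\<infinity>\<close>, \<open>v (\<xi>^(p^j)) = p^j v \<xi>\<close> tends to \<open>0\<close>; any fixed positive gain in the
  coefficient therefore wins in the end.\<close>

lemma frobenius_tail:
  assumes "(w::real) > 0"
  obtains B where "B < 0" "\<And>j a. j \<le> B \<Longrightarrow> v a \<ge> ereal w \<Longrightarrow> v (a * frob p j \<xi>) > 0"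
proof (cases "\<xi> = 0")
  case True
  show ?thesis
    by (rule that[of "-1"]) (use True valuation_zero[OF val] in auto)
next
  case False
  then obtain r where r: "v \<xi> = ereal r" using valuation_finite[OF val] by metis
  have "(\<lambda>n. inverse (real p) ^ n) \<longlonglongrightarrow> 0"
    by (rule LIMSEQ_power_zero) (use p_gt_1 in \<open>simp add: inverse_less_1_iff\<close>)
  hence "(\<lambda>n. w + inverse (real p) ^ n * r) \<longlonglongrightarrow> w + 0 * r"
    by (intro tendsto_add tendsto_mult tendsto_const)
  hence "\<forall>\<^sub>F n in sequentially. w + inverse (real p) ^ n * r > 0"
    using assms by (intro order_tendstoD) auto
  then obtain N where N: "\<And>n. n \<ge> N \<Longrightarrow> w + inverse (real p) ^ n * r > 0"
    by (auto simp: eventually_sequentially)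
  show ?thesis
  proof (rule that[of "- int N - 1"])
    fix j a assume j: "j \<le> - int N - 1" and a: "v a \<ge> ereal w"
    have "real p powi j = inverse (real p) ^ nat (- j)"
      using j by (simp add: power_int_def)
    hence "0 < ereal w + v (frob p j \<xi>)"
      using N[of "nat (- j)"] j r by (simp add: valuation_frob)
    also have "\<dots> \<le> v (a * frob p j \<xi>)"
      using a by (simp add: valuation_mult[OF val] add_right_mono)
    finally show "v (a * frob p j \<xi>) > 0" .
  qed simp
qed

end

section \<open>Contracting series\<close>

context perfect_valued_field
begin

text \<open>This class contains \<open>x\<close>, \<open>y\<close> and all integral twisted polynomials, so that scalars and the
  isomorphism are treated alike. The bound \<open>w\<close> has to be uniform: it must outweigh \<open>v (\<xi>^(p^j))\<close>,
  which may be negative but tends to \<open>0\<close>, for all sufficiently negative \<open>j\<close> at once.\<close>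

definition contracting :: "'a set \<Rightarrow> (int \<Rightarrow> 'a) \<Rightarrow> bool" where
  "contracting H f \<longleftrightarrow>
     (\<forall>i. f i \<in> H) \<and> (\<forall>i. v (f i) \<ge> 0) \<and> (\<exists>n. \<forall>i>n. f i = 0) \<and>
     (\<exists>w::real. w > 0 \<and> (\<forall>i<0. v (f i) \<ge> ereal w))"

lemma contracting_coeff:
  assumes "contracting H f"
  shows "f i \<in> H" "v (f i) \<ge> 0"
  using assms by (auto simp: contracting_def)

lemma finite_twisted_mult_support:
  fixes f g :: "int \<Rightarrow> 'a"
  assumes "\<forall>i>m. f i = 0" "\<forall>i>m'. g i = 0"
  shows "finite {i. f i \<noteq> 0 \<and> g (n - i) \<noteq> 0}"
proof (rule finite_subset)
  show "{i. f i \<noteq> 0 \<and> g (n - i) \<noteq> 0} \<subseteq> {n - m'..m}"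
  proof
    fix i assume i: "i \<in> {i. f i \<noteq> 0 \<and> g (n - i) \<noteq> 0}"
    have "\<not> i > m" "\<not> n - i > m'" using assms i by blast+
    thus "i \<in> {n - m'..m}" by simp
  qed
qed simp

lemma twisted_mult_eq_sum:
  assumes "finite F" "{i. f i \<noteq> 0 \<and> g (n - i) \<noteq> 0} \<subseteq> F"
  shows "twisted_mult p f g n = (\<Sum>i\<in>F. f i * frob p i (g (n - i) :: 'a))"
  unfolding twisted_mult_def using assms by (intro sum.mono_neutral_left) auto

lemma carrier_twisted_poly:
  "f \<in> carrier (twisted_poly p S) \<longleftrightarrow>
     (\<forall>i. f i \<in> S) \<and> (\<forall>i<0. f i = 0) \<and> (\<exists>m. \<forall>i>m. f i = 0)"
  by (simp add: twisted_poly_def)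

lemma twisted_poly_contracting:
  assumes "f \<in> carrier (twisted_poly p (val_ring v H))"
  shows "contracting H f"
  using assms valuation_zero[OF val]
  by (auto simp: twisted_poly_def contracting_def val_ring_def intro: exI[of _ 1])

lemma contracting_mono: "contracting H f \<Longrightarrow> H \<subseteq> H' \<Longrightarrow> contracting H' f"
  by (auto simp: contracting_def)

text \<open>Compare coefficients of \<open>\<tau>^n\<close> in \<open>x y = 1\<close> and solve for \<open>y n\<close>: since \<open>x\<close> is congruent to \<open>1\<close>, all
  other terms carry a small factor \<open>x i\<close> or \<open>x 0 - 1\<close>, while \<open>y\<close> is integral. The bound for \<open>y\<close>
  is thus the one for \<open>x\<close>, with no recursion on \<open>n\<close>.\<close>

lemma inverse_coeff_bound:
  assumes x: "\<forall>j>0. x j = 0" "v (x 0 - 1) \<ge> c" "\<forall>j<0. v (x j) \<ge> c"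
    and y: "\<forall>j>0. y j = 0" "\<forall>j. v (y j) \<ge> 0"
    and xy: "twisted_mult p x y = (\<lambda>i. if i = 0 then 1 else 0)" and n: "n < 0"
  shows "v (y n) \<ge> c"
proof -
  have mult_ge: "v (a * b) \<ge> c" if "v a \<ge> c" "v b \<ge> 0" for a b
    using that add_mono[of c "v a" 0 "v b"] by (simp add: valuation_mult[OF val])
  have "0 = twisted_mult p x y n" using xy n by simp
  also have "\<dots> = (\<Sum>i\<in>{n..0}. x i * frob p i (y (n - i)))"
    using x(1) y(1) by (intro twisted_mult_eq_sum) (force simp: not_less[symmetric])+
  also have "\<dots> = x 0 * y n + (\<Sum>i\<in>{n..0} - {0}. x i * frob p i (y (n - i)))"
    using n by (subst sum.remove[of _ 0]) auto
  finally have "y n = - ((\<Sum>i\<in>{n..0} - {0}. x i * frob p i (y (n - i))) + (x 0 - 1) * y n)"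
    by (simp add: algebra_simps eq_neg_iff_add_eq_0)
  moreover have "v ((\<Sum>i\<in>{n..0} - {0}. x i * frob p i (y (n - i))) + (x 0 - 1) * y n) \<ge> c"
    using x y valuation_frob_ge_0
    by (intro valuation_add_ge[OF val] valuation_sum_ge[OF val] mult_ge) auto
  ultimately show ?thesis using valuation_uminus[OF val] by metis
qed

end

section \<open>The action of contracting series on \<open>H/N\<close>\<close>

text \<open>\<open>H\<close> stands for \<open>K^alg\<close> or \<open>K^perf\<close>, and \<open>H/N\<close> for any of the three quotients in question.\<close>

locale frobenius_quotient = perfect_valued_field p v
  for p and v :: "'a::field \<Rightarrow> ereal" +
  fixes H N :: "'a set"
  assumes H_one: "1 \<in> H"
    and H_diff: "a \<in> H \<Longrightarrow> b \<in> H \<Longrightarrow> a - b \<in> H"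
    and H_mult: "a \<in> H \<Longrightarrow> b \<in> H \<Longrightarrow> a * b \<in> H"
    and H_frob: "a \<in> H \<Longrightarrow> frob p j a \<in> H"
    and N_cases: "N = max_ideal v H \<or> N = val_ring v H"
begin

lemma H_zero: "0 \<in> H"
  using H_diff[OF H_one H_one] by simp

lemma H_uminus: "a \<in> H \<Longrightarrow> - a \<in> H"
  using H_diff[OF H_zero] by simp

lemma H_add: "a \<in> H \<Longrightarrow> b \<in> H \<Longrightarrow> a + b \<in> H"
  using H_diff[of a "- b"] H_uminus by simp

lemma H_sum: "(\<And>i. i \<in> I \<Longrightarrow> f i \<in> H) \<Longrightarrow> (\<Sum>i\<in>I. f i) \<in> H"
  by (induction I rule: infinite_finite_induct) (auto simp: H_zero H_add)

lemma N_subset: "N \<subseteq> H"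
  using N_cases by (auto simp: max_ideal_def val_ring_def)

lemma N_zero: "0 \<in> N"
  using N_cases H_zero valuation_zero[OF val] by (auto simp: max_ideal_def val_ring_def)

lemma N_add: "a \<in> N \<Longrightarrow> b \<in> N \<Longrightarrow> a + b \<in> N"
  using N_cases valuation_add_ge[OF val, of 0 a b] valuation_add_gt[OF val, of 0 a b] H_add
  by (auto simp: max_ideal_def val_ring_def)

lemma N_uminus: "a \<in> N \<Longrightarrow> - a \<in> N"
  using N_cases H_uminus by (auto simp: max_ideal_def val_ring_def valuation_uminus[OF val])

lemma N_diff: "a \<in> N \<Longrightarrow> b \<in> N \<Longrightarrow> a - b \<in> N"
  using N_add[of a "- b"] N_uminus by simp

lemma N_sum: "(\<And>i. i \<in> I \<Longrightarrow> f i \<in> N) \<Longrightarrow> (\<Sum>i\<in>I. f i) \<in> N"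
  by (induction I rule: infinite_finite_induct) (auto simp: N_zero N_add)

lemma N_frob: "a \<in> N \<Longrightarrow> frob p j a \<in> N"
  using N_cases H_frob valuation_frob_ge_0 valuation_frob_gt_0
  by (auto simp: max_ideal_def val_ring_def)

lemma N_mult:
  assumes "c \<in> H" "v c \<ge> 0" "a \<in> N"
  shows "c * a \<in> N"
  using assms N_cases H_mult
  by (auto simp: max_ideal_def val_ring_def valuation_mult[OF val] add_nonneg_pos)

lemma N_gt_0: "a \<in> H \<Longrightarrow> v a > 0 \<Longrightarrow> a \<in> N"
  using N_cases by (auto simp: max_ideal_def val_ring_def)

lemma N_sym: "a - b \<in> N \<Longrightarrow> b - a \<in> N"
  using N_uminus[of "a - b"] by simp

lemma N_trans: "a - b \<in> N \<Longrightarrow> b - c \<in> N \<Longrightarrow> a - c \<in> N"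
  using N_add[of "a - b" "b - c"] by simp

abbreviation cls :: "'a \<Rightarrow> 'a set" where
  "cls \<equiv> residue_class H N"

abbreviation series :: "(int \<Rightarrow> 'a) \<Rightarrow> bool" where
  "series \<equiv> contracting H"

definition nonzero_terms :: "(int \<Rightarrow> 'a) \<Rightarrow> 'a \<Rightarrow> int set" where
  "nonzero_terms f \<xi> = {j. f j * frob p j \<xi> \<notin> N}"

text \<open>A representative in \<open>H\<close> of the class \<open>\<Sum>j. [f j * \<xi>^(p^j)]\<close>; only its class modulo \<open>N\<close> is
  meaningful.\<close>

definition series_value :: "(int \<Rightarrow> 'a) \<Rightarrow> 'a \<Rightarrow> 'a" where
  "series_value f \<xi> = (\<Sum>j\<in>nonzero_terms f \<xi>. f j * frob p j \<xi>)"

lemma term_in_H: "series f \<Longrightarrow> \<xi> \<in> H \<Longrightarrow> f j * frob p j \<xi> \<in> H"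
  by (simp add: contracting_coeff H_mult H_frob)

lemma term_in_N: "series f \<Longrightarrow> \<xi> \<in> N \<Longrightarrow> f j * frob p j \<xi> \<in> N"
  by (simp add: contracting_coeff N_mult N_frob)

lemma series_value_in_H: "series f \<Longrightarrow> \<xi> \<in> H \<Longrightarrow> series_value f \<xi> \<in> H"
  unfolding series_value_def by (intro H_sum term_in_H)

lemma finite_nonzero_terms:
  assumes f: "series f" and \<xi>: "\<xi> \<in> H"
  shows "finite (nonzero_terms f \<xi>)"
proof -
  obtain n and w :: real where n: "\<forall>i>n. f i = 0" and w: "w > 0" "\<forall>i<0. v (f i) \<ge> ereal w"
    using f by (auto simp: contracting_def)
  obtain B where B: "B < 0" "\<And>j a. j \<le> B \<Longrightarrow> v a \<ge> ereal w \<Longrightarrow> v (a * frob p j \<xi>) > 0"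
    using frobenius_tail[OF w(1)] by metis
  have "nonzero_terms f \<xi> \<subseteq> {B..n}"
  proof
    fix j assume j: "j \<in> nonzero_terms f \<xi>"
    have "\<not> j > n" using j n N_zero by (auto simp: nonzero_terms_def)
    moreover have "\<not> j \<le> B"
      using j B w(2) N_gt_0[OF term_in_H[OF f \<xi>, of j]] by (auto simp: nonzero_terms_def)
    ultimately show "j \<in> {B..n}" by simp
  qed
  thus ?thesis by (rule finite_subset) simp
qed

lemma series_value_eq_sum:
  assumes "series f" "\<xi> \<in> H" "finite F" "nonzero_terms f \<xi> \<subseteq> F"
  shows "series_value f \<xi> - (\<Sum>j\<in>F. f j * frob p j \<xi>) \<in> N"
proof -
  have "(\<Sum>j\<in>F. f j * frob p j \<xi>) =
      (\<Sum>j\<in>F - nonzero_terms f \<xi>. f j * frob p j \<xi>) + series_value f \<xi>"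
    unfolding series_value_def using assms by (intro sum.subset_diff)
  moreover have "(\<Sum>j\<in>F - nonzero_terms f \<xi>. f j * frob p j \<xi>) \<in> N"
    by (rule N_sum) (auto simp: nonzero_terms_def)
  ultimately show ?thesis using N_uminus by simp
qed

text \<open>The two values may have different sets of nonzero terms; both can be computed over the
  union, where the summation is additive in \<open>\<xi>\<close>. The same device proves additivity below.\<close>

lemma series_value_cong:
  assumes f: "series f" and "\<xi> \<in> H" "\<xi>' \<in> H" and d: "\<xi> - \<xi>' \<in> N"
  shows "series_value f \<xi> - series_value f \<xi>' \<in> N"
proof -
  define F where "F = nonzero_terms f \<xi> \<union> nonzero_terms f \<xi>'"
  have F: "finite F" using assms finite_nonzero_terms by (simp add: F_def)
  have "(\<Sum>j\<in>F. f j * frob p j (\<xi> - \<xi>')) \<in> N"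
    by (intro N_sum term_in_N[OF f d])
  hence "(\<Sum>j\<in>F. f j * frob p j \<xi>) - (\<Sum>j\<in>F. f j * frob p j \<xi>') \<in> N"
    by (simp add: frob_diff right_diff_distrib sum_subtractf)
  thus ?thesis
    using N_trans[OF N_trans[OF series_value_eq_sum[OF f assms(2) F]]
        N_sym[OF series_value_eq_sum[OF f assms(3) F]]]
    by (simp add: F_def)
qed

lemma series_value_add:
  assumes f: "series f" and \<xi>: "\<xi> \<in> H" "\<xi>' \<in> H"
  shows "series_value f (\<xi> + \<xi>') - (series_value f \<xi> + series_value f \<xi>') \<in> N"
proof -
  define F where "F = nonzero_terms f (\<xi> + \<xi>') \<union> nonzero_terms f \<xi> \<union> nonzero_terms f \<xi>'"
  have F: "finite F" using assms finite_nonzero_terms H_add by (simp add: F_def)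
  have *: "series_value f z - (\<Sum>j\<in>F. f j * frob p j z) \<in> N" if "z \<in> {\<xi> + \<xi>', \<xi>, \<xi>'}" for z
    using that \<xi> by (intro series_value_eq_sum[OF f _ F]) (auto simp: F_def H_add)
  have "(\<Sum>j\<in>F. f j * frob p j (\<xi> + \<xi>')) =
      (\<Sum>j\<in>F. f j * frob p j \<xi>) + (\<Sum>j\<in>F. f j * frob p j \<xi>')"
    by (simp add: frob_add distrib_left sum.distrib)
  thus ?thesis
    using N_diff[OF *[of "\<xi> + \<xi>'"] N_add[OF *[of \<xi>] *[of \<xi>']]] by (simp add: algebra_simps)
qed

lemma series_value_add_series:
  assumes f: "series f" and g: "series g" and fg: "series (\<lambda>i. f i + g i)" and \<xi>: "\<xi> \<in> H"
  shows "series_value (\<lambda>i. f i + g i) \<xi> - (series_value f \<xi> + series_value g \<xi>) \<in> N"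
proof -
  let ?h = "\<lambda>i. f i + g i"
  define F where "F = nonzero_terms ?h \<xi> \<union> nonzero_terms f \<xi> \<union> nonzero_terms g \<xi>"
  have F: "finite F" using assms finite_nonzero_terms by (simp add: F_def)
  have *: "series_value z \<xi> - (\<Sum>j\<in>F. z j * frob p j \<xi>) \<in> N" if "z \<in> {?h, f, g}" for z
    using that f g fg by (intro series_value_eq_sum[OF _ \<xi> F]) (auto simp: F_def)
  have "(\<Sum>j\<in>F. ?h j * frob p j \<xi>) = (\<Sum>j\<in>F. f j * frob p j \<xi>) + (\<Sum>j\<in>F. g j * frob p j \<xi>)"
    by (simp add: distrib_right sum.distrib)
  thus ?thesis
    using N_diff[OF *[of ?h] N_add[OF *[of f] *[of g]]] by (simp add: algebra_simps)
qed

text \<open>A double sum modulo \<open>N\<close> may be computed by first summing over the fibres of any map \<open>\<pi>\<close>, and each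
  fibre sum is needed only modulo \<open>N\<close>.\<close>

lemma sum_fibres_mod_N:
  assumes T: "finite T"
    and r: "\<And>n. r n - (\<Sum>e\<in>{e\<in>T. \<pi> e = n}. t e) \<in> N"
  shows "(\<Sum>n | r n \<notin> N. r n) - (\<Sum>e\<in>T. t e) \<in> N"
proof -
  have sub: "{n. r n \<notin> N} \<subseteq> \<pi> ` T"
  proof (clarify, rule ccontr)
    fix n assume n: "r n \<notin> N" "n \<notin> \<pi> ` T"
    hence "{e\<in>T. \<pi> e = n} = {}" by auto
    with r[of n] n show False by (metis diff_zero sum.empty)
  qed
  have "(\<Sum>n\<in>\<pi> ` T. r n) = (\<Sum>n\<in>\<pi> ` T - {n. r n \<notin> N}. r n) + (\<Sum>n | r n \<notin> N. r n)"
    using T sub by (intro sum.subset_diff) auto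
  moreover have "(\<Sum>n\<in>\<pi> ` T - {n. r n \<notin> N}. r n) \<in> N"
    by (rule N_sum) auto
  moreover have "(\<Sum>n\<in>\<pi> ` T. r n) - (\<Sum>e\<in>T. t e) \<in> N"
    using N_sum[of "\<pi> ` T" "\<lambda>n. r n - (\<Sum>e\<in>{e\<in>T. \<pi> e = n}. t e)"] r
    by (simp add: sum_subtractf sum.image_gen[OF T, of t \<pi>])
  ultimately show "(\<Sum>n | r n \<notin> N. r n) - (\<Sum>e\<in>T. t e) \<in> N"
    using N_diff[of "(\<Sum>n\<in>\<pi> ` T. r n) - (\<Sum>e\<in>T. t e)" "\<Sum>n\<in>\<pi> ` T - {n. r n \<notin> N}. r n"]
    by (simp add: algebra_simps)
qed

text \<open>Both sides are the sum of the doubly indexed terms \<open>f i * (g j * \<xi>^(p^j))^(p^i)\<close>, of which only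
  finitely many lie outside \<open>N\<close>: the left side groups them by \<open>i + j\<close>, the right side by \<open>i\<close>.\<close>

lemma series_value_mult:
  assumes f: "series f" and g: "series g" and \<xi>: "\<xi> \<in> H"
  shows "series_value (twisted_mult p f g) \<xi> - series_value f (series_value g \<xi>) \<in> N"
proof -
  define \<eta> where "\<eta> = series_value g \<xi>"
  define t where "t = (\<lambda>(i, j). f i * frob p i (g j * frob p j \<xi>))"
  define T where "T = {e. t e \<notin> N}"
  have \<eta>: "\<eta> \<in> H" unfolding \<eta>_def using g \<xi> by (rule series_value_in_H)
  have fi: "f i \<in> H" "v (f i) \<ge> 0" for i using contracting_coeff[OF f] by auto
  \<comment> \<open>If the inner factor lies in \<open>N\<close>, then so does the whole term; this leaves finitely many \<open>j\<close>,
    and for each of them finitely many \<open>i\<close>.\<close>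
  have "T \<subseteq> (\<Union>j\<in>nonzero_terms g \<xi>. (\<lambda>i. (i, j)) ` nonzero_terms f (g j * frob p j \<xi>))"
    using N_frob fi N_mult by (fastforce simp: T_def t_def nonzero_terms_def)
  moreover have "finite \<dots>"
    using finite_nonzero_terms f g \<xi> term_in_H by (intro finite_UN_I finite_imageI) auto
  ultimately have T: "finite T" by (rule finite_subset)

  have "twisted_mult p f g n * frob p n \<xi> - (\<Sum>e\<in>{e\<in>T. fst e + snd e = n}. t e) \<in> N" for n
  proof -
    obtain m m' where m: "\<forall>i>m. f i = 0" "\<forall>i>m'. g i = 0"
      using f g by (auto simp: contracting_def)
    define S where "S = {i. f i \<noteq> 0 \<and> g (n - i) \<noteq> 0}"
    define E where "E = (\<lambda>i. (i, n - i)) ` S"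
    have S: "finite S" unfolding S_def using m by (rule finite_twisted_mult_support)
    have "twisted_mult p f g n * frob p n \<xi> = (\<Sum>i\<in>S. t (i, n - i))"
      by (simp add: twisted_mult_def S_def t_def sum_distrib_right frob_mult frob_frob mult.assoc)
    also have "\<dots> = (\<Sum>e\<in>E. t e)"
      unfolding E_def by (subst sum.reindex) (auto simp: inj_on_def)
    also have "\<dots> = (\<Sum>e\<in>E - T. t e) + (\<Sum>e\<in>{e\<in>T. fst e + snd e = n}. t e)"
    proof -
      have "{e\<in>T. fst e + snd e = n} \<subseteq> E"
      proof
        fix e assume "e \<in> {e\<in>T. fst e + snd e = n}"
        then obtain i where e: "e = (i, n - i)" "t e \<notin> N"
          by (cases e) (auto simp: T_def algebra_simps)
        hence "t e \<noteq> 0" using N_zero by auto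
        hence "i \<in> S" by (auto simp: S_def t_def e)
        thus "e \<in> E" by (auto simp: E_def e)
      qed
      moreover have "E - T = E - {e\<in>T. fst e + snd e = n}" by (auto simp: E_def)
      ultimately show ?thesis using S by (simp add: E_def sum.subset_diff)
    qed
    finally show ?thesis using N_sum[of "E - T" t] by (simp add: T_def)
  qed
  from sum_fibres_mod_N[OF T this]
  have 1: "series_value (twisted_mult p f g) \<xi> - (\<Sum>e\<in>T. t e) \<in> N"
    by (simp add: series_value_def nonzero_terms_def)

  have "f i * frob p i \<eta> - (\<Sum>e\<in>{e\<in>T. fst e = i}. t e) \<in> N" for i
  proof -
    \<comment> \<open>The range of \<open>j\<close> must both compute \<open>\<eta>\<close> and cover every exceptional index in \<open>T\<close>.\<close>
    define F where "F = snd ` T \<union> nonzero_terms g \<xi>"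
    define T' where "T' = {e\<in>T. fst e = i}"
    have F: "finite F" using T finite_nonzero_terms[OF g \<xi>] by (simp add: F_def)
    have "\<eta> - (\<Sum>j\<in>F. g j * frob p j \<xi>) \<in> N"
      unfolding \<eta>_def by (rule series_value_eq_sum[OF g \<xi> F]) (simp add: F_def)
    from term_in_N[OF f this, of i]
    have "f i * frob p i \<eta> - (\<Sum>j\<in>F. t (i, j)) \<in> N"
      by (simp add: frob_diff frob_sum right_diff_distrib sum_distrib_left t_def)
    moreover have "(\<Sum>j\<in>F. t (i, j)) = (\<Sum>e\<in>Pair i ` F. t e)"
      by (subst sum.reindex) (auto simp: inj_on_def)
    moreover have "\<dots> = (\<Sum>e\<in>Pair i ` F - T'. t e) + (\<Sum>e\<in>T'. t e)"
      using F by (intro sum.subset_diff) (force simp: F_def T'_def)+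
    moreover have "(\<Sum>e\<in>Pair i ` F - T'. t e) \<in> N"
      by (rule N_sum) (auto simp: T'_def T_def)
    ultimately show ?thesis
      using N_add[of "f i * frob p i \<eta> - (\<Sum>j\<in>F. t (i, j))" "\<Sum>e\<in>Pair i ` F - T'. t e"]
      by (simp add: T'_def)
  qed
  from sum_fibres_mod_N[OF T this]
  have 2: "series_value f \<eta> - (\<Sum>e\<in>T. t e) \<in> N"
    by (simp add: series_value_def nonzero_terms_def)
  show ?thesis
    using N_trans[OF 1 N_sym[OF 2]] by (simp add: \<eta>_def)
qed

lemma series_one: "series (\<lambda>i. if i = 0 then 1 else 0)"
  unfolding contracting_def
  by (auto simp: H_one H_zero valuation_zero[OF val] valuation_one[OF val] intro: exI[of _ 0] exI[of _ 1])

lemma series_value_one: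
  assumes "\<xi> \<in> H"
  shows "series_value (\<lambda>i. if i = 0 then 1 else 0) \<xi> - \<xi> \<in> N"
proof -
  have "nonzero_terms (\<lambda>i. if i = 0 then 1 else 0) \<xi> \<subseteq> {0}"
    using N_zero by (auto simp: nonzero_terms_def)
  from series_value_eq_sum[OF series_one assms _ this] show ?thesis by simp
qed

lemma tau_apply_eq_series_value:
  assumes f: "series f" "\<forall>i<0. f i = 0" and \<xi>: "\<xi> \<in> H"
  shows "series_value f \<xi> - tau_apply p f \<xi> \<in> N"
proof -
  obtain m where m: "\<forall>i>m. f i = 0" using f by (auto simp: contracting_def)
  have "{i. f i \<noteq> 0} \<subseteq> {0..m}"
    using m f(2) by (force simp: not_less[symmetric])
  hence "finite {i. f i \<noteq> 0}" by (rule finite_subset) simp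
  thus ?thesis
    unfolding tau_apply_def using N_zero
    by (intro series_value_eq_sum[OF f(1) \<xi>]) (auto simp: nonzero_terms_def)
qed

end

section \<open>Quotient modules\<close>

lemma subset_ring_cring:
  fixes S :: "'a::field set"
  assumes one: "1 \<in> S" and diff: "\<And>a b. a \<in> S \<Longrightarrow> b \<in> S \<Longrightarrow> a - b \<in> S"
    and mult: "\<And>a b. a \<in> S \<Longrightarrow> b \<in> S \<Longrightarrow> a * b \<in> S"
  shows "cring (subset_ring S)"
proof -
  have zero: "0 \<in> S" using diff[OF one one] by simp
  have neg: "- a \<in> S" if "a \<in> S" for a using diff[OF zero that] by simp
  have add: "a + b \<in> S" if "a \<in> S" "b \<in> S" for a b
    using diff[OF that(1) neg[OF that(2)]] by simp
  show ?thesis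
  proof (intro cringI abelian_groupI comm_monoidI)
    fix a assume "a \<in> carrier (subset_ring S)"
    thus "\<exists>b\<in>carrier (subset_ring S). b \<oplus>\<^bsub>subset_ring S\<^esub> a = \<zero>\<^bsub>subset_ring S\<^esub>"
      using neg by (intro bexI[of _ "- a"]) (auto simp: ring_of_type_algebra_def)
  qed (auto simp: ring_of_type_algebra_def algebra_simps one zero add mult)
qed

lemma additive_subgroup_subset_ring:
  fixes S I :: "'a::field set"
  assumes S: "cring (subset_ring S)" and I: "I \<subseteq> S" "0 \<in> I"
    and diff: "\<And>a b. a \<in> I \<Longrightarrow> b \<in> I \<Longrightarrow> a - b \<in> I"
  shows "additive_subgroup I (subset_ring S)"
proof (rule additive_subgroupI)
  interpret cring "subset_ring S" by (rule S)
  have neg: "- a \<in> I" if "a \<in> I" for a using diff[OF I(2) that] by simp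
  show "subgroup I (add_monoid (subset_ring S))"
  proof (rule add.subgroupI)
    fix a assume a: "a \<in> I"
    hence "- a = \<ominus>\<^bsub>subset_ring S\<^esub> a"
      using neg[OF a] I by (intro minus_equality[symmetric]) (auto simp: ring_of_type_algebra_def)
    thus "\<ominus>\<^bsub>subset_ring S\<^esub> a \<in> I" using neg[OF a] by simp
  next
    fix a b assume "a \<in> I" "b \<in> I"
    thus "a \<oplus>\<^bsub>subset_ring S\<^esub> b \<in> I"
      using diff[of a "- b"] neg by (simp add: ring_of_type_algebra_def)
  qed (use I in auto)
qed

lemma twisted_poly_homD:
  assumes "\<phi> \<in> ring_hom A (twisted_poly p S)"
  shows "a \<in> carrier A \<Longrightarrow> \<phi> a \<in> carrier (twisted_poly p S)"
    and "a \<in> carrier A \<Longrightarrow> \<forall>i<0. \<phi> a i = 0"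
    and "\<phi> \<one>\<^bsub>A\<^esub> = (\<lambda>i. if i = 0 then 1 else 0)"
    and "a \<in> carrier A \<Longrightarrow> b \<in> carrier A \<Longrightarrow> \<phi> (a \<oplus>\<^bsub>A\<^esub> b) = (\<lambda>i. \<phi> a i + \<phi> b i)"
    and "a \<in> carrier A \<Longrightarrow> b \<in> carrier A \<Longrightarrow> \<phi> (a \<otimes>\<^bsub>A\<^esub> b) = twisted_mult p (\<phi> a) (\<phi> b)"
  using ring_hom_closed[OF assms] ring_hom_one[OF assms] ring_hom_add[OF assms]
    ring_hom_mult[OF assms]
  by (simp_all add: twisted_poly_def twisted_laurent_def)

lemma twisted_poly_hom_mono:
  assumes "\<phi> \<in> ring_hom A (twisted_poly p S)" "S \<subseteq> S'"
  shows "\<phi> \<in> ring_hom A (twisted_poly p S')"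
proof (rule ring_hom_memI)
  fix a assume "a \<in> carrier A"
  thus "\<phi> a \<in> carrier (twisted_poly p S')"
    using twisted_poly_homD(1)[OF assms(1)] assms(2) by (force simp: twisted_poly_def)
qed (simp_all add: twisted_poly_homD[OF assms(1)] twisted_poly_def twisted_laurent_def)

context frobenius_quotient
begin

lemma cring_H: "cring (subset_ring H)"
  by (intro subset_ring_cring H_one H_diff H_mult)

lemma abelian_subgroup_N: "abelian_subgroup N (subset_ring H)"
proof (rule abelian_subgroupI3)
  show "additive_subgroup N (subset_ring H)"
    by (rule additive_subgroup_subset_ring[OF cring_H]) (auto simp: N_subset N_zero N_diff)
  show "abelian_group (subset_ring H)"
    using cring_H cring.axioms(1) ring.is_abelian_group by blast
qed

lemma mem_cls: "z \<in> cls a \<longleftrightarrow> z - a \<in> N"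
proof -
  have "z \<in> cls a \<longleftrightarrow> (\<exists>n\<in>N. z = n + a)"
    by (simp add: a_r_coset_def' ring_of_type_algebra_def)
  also have "\<dots> \<longleftrightarrow> z - a \<in> N"
    by (auto intro!: bexI[of _ "z - a"])
  finally show ?thesis .
qed

lemma cls_eq_iff: "cls a = cls b \<longleftrightarrow> a - b \<in> N"
proof
  assume "cls a = cls b"
  thus "a - b \<in> N" using mem_cls[of a a] mem_cls[of a b] N_zero by simp
next
  assume "a - b \<in> N"
  hence "z - a \<in> N \<longleftrightarrow> z - b \<in> N" for z
    using N_trans[of z a b] N_trans[of z b a] N_sym by blast
  thus "cls a = cls b" by (simp add: set_eq_iff mem_cls)
qed

lemma cls_eq_N_iff: "cls a = N \<longleftrightarrow> a \<in> N"
proof -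
  have "cls 0 = N" by (auto simp: mem_cls)
  thus ?thesis using cls_eq_iff[of a 0] by simp
qed

lemma carrier_quotient: "carrier (quotient_module p H N \<phi>) = cls ` H"
  by (auto simp: quotient_module_def A_RCOSETS_def')

lemma zero_quotient: "\<zero>\<^bsub>quotient_module p H N \<phi>\<^esub> = N"
  by (simp add: quotient_module_def)

lemma add_quotient:
  assumes "a \<in> H" "b \<in> H"
  shows "cls a \<oplus>\<^bsub>quotient_module p H N \<phi>\<^esub> cls b = cls (a + b)"
proof -
  interpret abelian_subgroup N "subset_ring H" by (rule abelian_subgroup_N)
  show ?thesis
    using a_rcos_sum[of a b] assms by (simp add: quotient_module_def ring_of_type_algebra_def)
qed

lemma abelian_group_quotient: "abelian_group (quotient_module p H N \<phi>)"
proof (rule abelian_groupI, unfold carrier_quotient)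
  have N: "\<zero>\<^bsub>quotient_module p H N \<phi>\<^esub> = cls 0"
    unfolding zero_quotient by (rule sym) (simp add: cls_eq_N_iff N_zero)
  show "\<zero>\<^bsub>quotient_module p H N \<phi>\<^esub> \<in> cls ` H"
    using H_zero by (auto simp: N)
  fix C assume "C \<in> cls ` H"
  then obtain a where a: "C = cls a" "a \<in> H" by blast
  show "\<zero>\<^bsub>quotient_module p H N \<phi>\<^esub> \<oplus>\<^bsub>quotient_module p H N \<phi>\<^esub> C = C"
    using a by (simp add: N add_quotient H_zero)
  show "\<exists>D\<in>cls ` H. D \<oplus>\<^bsub>quotient_module p H N \<phi>\<^esub> C = \<zero>\<^bsub>quotient_module p H N \<phi>\<^esub>"
  proof
    show "cls (- a) \<in> cls ` H" using a H_uminus by blast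
    show "cls (- a) \<oplus>\<^bsub>quotient_module p H N \<phi>\<^esub> C = \<zero>\<^bsub>quotient_module p H N \<phi>\<^esub>"
      using a by (simp add: N add_quotient H_uminus)
  qed
qed (auto simp: add_quotient H_add ac_simps)

lemma finsum_quotient:
  assumes "finite J" "\<And>j. j \<in> J \<Longrightarrow> f j \<in> H"
  shows "finsum (quotient_module p H N \<phi>) (\<lambda>j. cls (f j)) J = cls (\<Sum>j\<in>J. f j)"
proof -
  interpret abelian_group "quotient_module p H N \<phi>" by (rule abelian_group_quotient)
  show ?thesis
    using assms
  proof (induction J)
    case empty
    show ?case using cls_eq_N_iff[of 0] N_zero by (simp add: zero_quotient)
  next
    case (insert j J)
    thus ?case
      by (subst finsum_insert) (auto simp: carrier_quotient add_quotient H_sum)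
  qed
qed

text \<open>For contracting \<open>f\<close> all members of a residue class \<open>C\<close> contribute the same class, so the union
  merely avoids choosing one; this is also the shape of scalar multiplication in \<open>quotient_module\<close>.\<close>

definition series_action :: "(int \<Rightarrow> 'a) \<Rightarrow> 'a set \<Rightarrow> 'a set" where
  "series_action f C = (\<Union>\<xi>\<in>C. cls (series_value f \<xi>))"

lemma series_action_cls:
  assumes f: "series f" and \<xi>: "\<xi> \<in> H"
  shows "series_action f (cls \<xi>) = cls (series_value f \<xi>)"
proof -
  have "cls (series_value f \<xi>') = cls (series_value f \<xi>)" if "\<xi>' \<in> cls \<xi>" for \<xi>'
  proof -
    have *: "\<xi>' - \<xi> \<in> N" using that by (simp add: mem_cls)
    hence "\<xi>' - \<xi> + \<xi> \<in> H" using N_subset \<xi> H_add[of "\<xi>' - \<xi>" \<xi>] by auto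
    hence "series_value f \<xi>' - series_value f \<xi> \<in> N"
      using * by (intro series_value_cong[OF f _ \<xi>]) simp_all
    thus ?thesis by (rule cls_eq_iff[THEN iffD2])
  qed
  moreover have "\<xi> \<in> cls \<xi>" by (simp add: mem_cls N_zero)
  ultimately show ?thesis unfolding series_action_def by blast
qed

lemma series_action_closed: "series f \<Longrightarrow> C \<in> cls ` H \<Longrightarrow> series_action f C \<in> cls ` H"
  by (auto simp: series_action_cls series_value_in_H)

lemma series_action_add:
  assumes "series f" "C \<in> cls ` H" "D \<in> cls ` H"
  shows "series_action f (C \<oplus>\<^bsub>quotient_module p H N \<phi>\<^esub> D) =
    series_action f C \<oplus>\<^bsub>quotient_module p H N \<phi>'\<^esub> series_action f D"
proof -
  obtain \<xi> \<zeta> where "C = cls \<xi>" "\<xi> \<in> H" "D = cls \<zeta>" "\<zeta> \<in> H"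
    using assms(2,3) by blast
  thus ?thesis
    using assms(1) by (simp add: series_action_cls series_value_in_H add_quotient H_add
        cls_eq_iff series_value_add)
qed

lemma series_action_add_series:
  assumes "series f" "series g" "series (\<lambda>i. f i + g i)" "C \<in> cls ` H"
  shows "series_action (\<lambda>i. f i + g i) C =
    series_action f C \<oplus>\<^bsub>quotient_module p H N \<phi>\<^esub> series_action g C"
proof -
  obtain \<xi> where "C = cls \<xi>" "\<xi> \<in> H" using assms(4) by blast
  thus ?thesis
    using assms by (simp add: series_action_cls series_value_in_H add_quotient cls_eq_iff
        series_value_add_series)
qed

lemma series_action_mult:
  assumes "series f" "series g" "series (twisted_mult p f g)" "C \<in> cls ` H"
  shows "series_action (twisted_mult p f g) C = series_action f (series_action g C)"
proof -
  obtain \<xi> where "C = cls \<xi>" "\<xi> \<in> H" using assms(4) by blast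
  thus ?thesis
    using assms by (simp add: series_action_cls series_value_in_H cls_eq_iff series_value_mult)
qed

lemma series_action_one:
  assumes "C \<in> cls ` H"
  shows "series_action (\<lambda>i. if i = 0 then 1 else 0) C = C"
proof -
  obtain \<xi> where "C = cls \<xi>" "\<xi> \<in> H" using assms by blast
  thus ?thesis
    by (simp only: series_action_cls[OF series_one] cls_eq_iff series_value_one)
qed

lemma smult_quotient:
  assumes \<phi>: "series (\<phi> a)" "\<forall>i<0. \<phi> a i = 0" and C: "C \<in> cls ` H"
  shows "a \<odot>\<^bsub>quotient_module p H N \<phi>\<^esub> C = series_action (\<phi> a) C"
proof -
  have "cls (tau_apply p (\<phi> a) \<xi>) = cls (series_value (\<phi> a) \<xi>)" if "\<xi> \<in> C" for \<xi>
  proof -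
    obtain \<zeta> where \<zeta>: "\<zeta> \<in> H" "C = cls \<zeta>" using C by blast
    hence "\<xi> - \<zeta> \<in> N" using that by (simp only: mem_cls)
    hence "\<xi> \<in> H" using H_add[of "\<xi> - \<zeta>" \<zeta>] N_subset \<zeta>(1) by auto
    from N_sym[OF tau_apply_eq_series_value[OF \<phi> this]] show ?thesis
      by (rule cls_eq_iff[THEN iffD2])
  qed
  thus ?thesis by (simp add: quotient_module_def series_action_def cong: SUP_cong)
qed

lemma given_by_series_action:
  assumes f: "series f" "\<forall>j>0. f j = 0"
    and h: "\<And>\<xi>. \<xi> \<in> H \<Longrightarrow> h (cls \<xi>) = series_action f (cls \<xi>)"
  shows "given_by_series p H N (quotient_module p H N \<phi>) f h"
proof -
  have "{j. j \<le> 0 \<and> cls (f j * frob p j \<xi>) \<noteq> N} = nonzero_terms f \<xi>" for \<xi>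
    using f(2) N_zero by (auto simp: nonzero_terms_def cls_eq_N_iff not_less[symmetric])
  thus ?thesis
    unfolding given_by_series_def Let_def
    by (simp add: zero_quotient finsum_quotient finite_nonzero_terms[OF f(1)] term_in_H[OF f(1)]
        series_action_cls[OF f(1)] h series_value_def)
qed

lemma module_quotient:
  assumes A: "cring A" and \<phi>: "\<phi> \<in> ring_hom A (twisted_poly p (val_ring v H))"
  shows "Module.module A (quotient_module p H N \<phi>)"
proof -
  interpret cring A by (rule A)
  note carrier = carrier_quotient[of \<phi>]
  have smult: "a \<odot>\<^bsub>quotient_module p H N \<phi>\<^esub> C = series_action (\<phi> a) C"
    if "a \<in> carrier A" "C \<in> cls ` H" for a C
    by (rule smult_quotient[of \<phi> a, OF twisted_poly_contracting[OF twisted_poly_homD(1)[OF \<phi> that(1)]]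
        twisted_poly_homD(2)[OF \<phi> that(1)] that(2)])
  have series: "series (\<phi> a)" if "a \<in> carrier A" for a
    by (rule twisted_poly_contracting[OF twisted_poly_homD(1)[OF \<phi> that]])
  have closed: "series_action (\<phi> a) C \<in> cls ` H" if "a \<in> carrier A" "C \<in> cls ` H" for a C
    using that by (intro series_action_closed series)
  show ?thesis
  proof (rule moduleI[OF A abelian_group_quotient], unfold carrier)
    fix a b C assume *: "a \<in> carrier A" "b \<in> carrier A" "C \<in> cls ` H"
    have 1: "\<phi> (a \<oplus>\<^bsub>A\<^esub> b) = (\<lambda>i. \<phi> a i + \<phi> b i)" "\<phi> (a \<otimes>\<^bsub>A\<^esub> b) = twisted_mult p (\<phi> a) (\<phi> b)"
      using * by (simp_all add: twisted_poly_homD(4,5)[OF \<phi>])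
    show "(a \<oplus>\<^bsub>A\<^esub> b) \<odot>\<^bsub>quotient_module p H N \<phi>\<^esub> C =
        a \<odot>\<^bsub>quotient_module p H N \<phi>\<^esub> C \<oplus>\<^bsub>quotient_module p H N \<phi>\<^esub> b \<odot>\<^bsub>quotient_module p H N \<phi>\<^esub> C"
      using * series[of "a \<oplus>\<^bsub>A\<^esub> b"] unfolding 1
      by (simp add: smult 1 series series_action_add_series)
    show "(a \<otimes>\<^bsub>A\<^esub> b) \<odot>\<^bsub>quotient_module p H N \<phi>\<^esub> C =
        a \<odot>\<^bsub>quotient_module p H N \<phi>\<^esub> (b \<odot>\<^bsub>quotient_module p H N \<phi>\<^esub> C)"
      using * series[of "a \<otimes>\<^bsub>A\<^esub> b"] unfolding 1
      by (simp add: smult 1 series series_action_mult closed)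
  next
    fix a C D assume *: "a \<in> carrier A" "C \<in> cls ` H" "D \<in> cls ` H"
    have "C \<oplus>\<^bsub>quotient_module p H N \<phi>\<^esub> D \<in> cls ` H"
      using *(2,3) by (auto simp: add_quotient H_add)
    thus "a \<odot>\<^bsub>quotient_module p H N \<phi>\<^esub> (C \<oplus>\<^bsub>quotient_module p H N \<phi>\<^esub> D) =
        a \<odot>\<^bsub>quotient_module p H N \<phi>\<^esub> C \<oplus>\<^bsub>quotient_module p H N \<phi>\<^esub> a \<odot>\<^bsub>quotient_module p H N \<phi>\<^esub> D"
      using * by (simp add: smult series_action_add[OF series])
  next
    fix C assume "C \<in> cls ` H"
    thus "\<one>\<^bsub>A\<^esub> \<odot>\<^bsub>quotient_module p H N \<phi>\<^esub> C = C"
      by (simp add: smult twisted_poly_homD(3)[OF \<phi>] series_action_one)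
  qed (simp_all add: smult closed)
qed

text \<open>Multiplicativity of the action turns \<open>x y = y x = 1\<close> into mutually inverse bijections, and
  \<open>\<psi>_a x = x \<phi>_a\<close> into \<open>A\<close>-linearity.\<close>

theorem series_module_iso_action:
  assumes A: "cring A" and \<phi>: "\<phi> \<in> ring_hom A (twisted_poly p (val_ring v H))" and \<psi>: "\<psi> \<in> ring_hom A (twisted_poly p (val_ring v H))"
    and x: "series x" "\<forall>j>0. x j = 0" and y: "series y" "\<forall>j>0. y j = 0"
    and xy: "twisted_mult p x y = (\<lambda>i. if i = 0 then 1 else 0)"
    and yx: "twisted_mult p y x = (\<lambda>i. if i = 0 then 1 else 0)"
    and comm: "\<And>a. a \<in> carrier A \<Longrightarrow> twisted_mult p (\<psi> a) x = twisted_mult p x (\<phi> a)"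
  shows "series_module_iso p A H N \<phi> \<psi> x y (series_action x)"
proof -
  have inv: "series_action x (series_action y C) = C" "series_action y (series_action x C) = C"
    if "C \<in> cls ` H" for C
    using that series_action_mult[OF x(1) y(1)] series_action_mult[OF y(1) x(1)]
      series_one series_action_one by (simp_all add: xy yx)
  have bij: "bij_betw (series_action x) (cls ` H) (cls ` H)"
    by (rule bij_betwI[where g = "series_action y"])
       (auto simp: inv intro: series_action_closed[OF x(1)] series_action_closed[OF y(1)])
  have smult: "series_action x (a \<odot>\<^bsub>quotient_module p H N \<phi>\<^esub> C) =
      a \<odot>\<^bsub>quotient_module p H N \<psi>\<^esub> series_action x C"
    if a: "a \<in> carrier A" and C: "C \<in> cls ` H" for a C
  proof -
    have s: "series (\<phi> a)" "\<forall>i<0. \<phi> a i = 0" "series (\<psi> a)" "\<forall>i<0. \<psi> a i = 0"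
      using twisted_poly_homD(1,2)[OF \<phi> a] twisted_poly_homD(1,2)[OF \<psi> a]
      by (simp_all add: twisted_poly_contracting)
    obtain \<xi> where \<xi>: "C = cls \<xi>" "\<xi> \<in> H" using C by blast
    have "series_value x (series_value (\<phi> a) \<xi>) - series_value (\<psi> a) (series_value x \<xi>) \<in> N"
      using N_trans[OF N_sym[OF series_value_mult[OF x(1) s(1) \<xi>(2)]]]
        series_value_mult[OF s(3) x(1) \<xi>(2)] comm[OF a] by simp
    thus ?thesis
      using s x(1) \<xi> imageI[OF series_value_in_H[OF x(1) \<xi>(2)], of cls] imageI[OF \<xi>(2), of cls]
      by (simp add: smult_quotient series_action_cls series_value_in_H cls_eq_iff)
  qed
  have "module_iso A (quotient_module p H N \<phi>) (quotient_module p H N \<psi>) (series_action x)"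
    unfolding module_iso_def iso_def
    using module_quotient[OF A \<phi>] module_quotient[OF A \<psi>] bij smult
    by (auto simp: carrier_quotient hom_def series_action_add[OF x(1)] series_action_closed[OF x(1)])
  moreover have "given_by_series p H N (quotient_module p H N \<psi>) x (series_action x)"
    using x by (rule given_by_series_action) simp
  moreover have "given_by_series p H N (quotient_module p H N \<phi>) y
      (inv_into (carrier (quotient_module p H N \<phi>)) (series_action x))"
  proof (rule given_by_series_action[OF y])
    fix \<xi> assume "\<xi> \<in> H"
    thus "inv_into (carrier (quotient_module p H N \<phi>)) (series_action x) (cls \<xi>) =
        series_action y (cls \<xi>)"
      using bij inv series_action_closed[OF y(1)] unfolding carrier_quotient
      by (intro inv_into_f_eq) (auto simp: bij_betw_def)
  qed
  ultimately show ?thesis by (simp add: series_module_iso_def)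
qed

end

section \<open>Local fields and their perfections\<close>

lemma valuation_ring_cring:
  assumes w: "valuation w" and S: "1 \<in> S" "\<And>a b. a \<in> S \<Longrightarrow> b \<in> S \<Longrightarrow> a - b \<in> S"
    "\<And>a b. a \<in> S \<Longrightarrow> b \<in> S \<Longrightarrow> a * b \<in> S"
  shows "cring (subset_ring (val_ring w S))"
proof (rule subset_ring_cring)
  fix a b assume "a \<in> val_ring w S" "b \<in> val_ring w S"
  thus "a - b \<in> val_ring w S" "a * b \<in> val_ring w S"
    using S valuation_add_ge[OF w, of 0 a "- b"]
    by (auto simp: val_ring_def valuation_mult[OF w] valuation_uminus[OF w])
qed (use S valuation_one[OF w] in \<open>simp add: val_ring_def\<close>)

text \<open>The coefficient ring is an intersection of valuation rings.\<close>

lemma regular_outside_cring: "cring (regular_outside winf)"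
  unfolding regular_outside_def
proof (rule subset_ring_cring; clarify)
  fix a b :: 'a and w assume
    ab: "\<forall>w. place w \<and> w \<noteq> winf \<longrightarrow> 0 \<le> w a" "\<forall>w. place w \<and> w \<noteq> winf \<longrightarrow> 0 \<le> w b"
    and w: "place w" "w \<noteq> winf"
  have v: "valuation w" using w by (simp add: place_def)
  show "0 \<le> w (a - b)" "0 \<le> w (a * b)"
    using ab w valuation_add_ge[OF v, of 0 a "- b"]
    by (auto simp: valuation_mult[OF v] valuation_uminus[OF v])
qed (simp add: place_def valuation_one)

text \<open>This provides the roots that make \<open>K^alg\<close> a perfect field.\<close>

lemma (in algebraically_closed) ex_root_binomial:
  fixes n :: nat
  assumes n: "n > 0" and z: "z \<in> carrier L"
  shows "\<exists>u\<in>carrier L. u [^] n = z"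
proof -
  define P where "P = \<one> # replicate (n - 1) \<zero> @ [\<ominus> z]"
  have eval: "eval (replicate k \<zero> @ [c]) u = c" if "u \<in> carrier L" "c \<in> carrier L" for k c u
    using that by (induction k) auto
  have P: "P \<in> carrier (poly_ring L)"
    using z by (auto simp: P_def univ_poly_carrier[symmetric] polynomial_def)
  hence "size (roots P) = n"
    using roots_over_carrier n by (simp add: splitted_def P_def)
  then obtain u where "u \<in># roots P"
    using n by (metis multiset_nonemptyE size_empty less_numeral_extra(3))
  hence u: "u \<in> carrier L" "eval P u = \<zero>"
    using roots_mem_iff_is_root[OF P] by (auto simp: is_root_def)
  hence "u [^] n \<ominus> z = \<zero>"
    using eval[of u "\<ominus> z" "n - 1"] z n by (simp add: P_def a_minus_def)
  hence "u [^] n = z" using u z by (simp add: r_right_minus_eq)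
  thus ?thesis using u by blast
qed

lemma ring_of_type_algebra_pow:
  "u [^]\<^bsub>(ring_of_type_algebra :: 'a::field ring)\<^esub> (n::nat) = u ^ n"
proof -
  interpret field "ring_of_type_algebra :: 'a ring" by (rule field_from_type_algebra)
  show ?thesis
    by (induction n) (auto simp: ring_of_type_algebra_def nat_pow_def mult.commute)
qed

locale local_field =
  fixes p :: nat and K :: "'a::field set" and v :: "'a \<Rightarrow> ereal"
  assumes local_field: "local_field_with_closure p K v"
begin

sublocale perfect_valued_field p v
proof
  show "prime p" "CHAR('a) = p" "valuation v"
    using local_field by (simp_all add: local_field_with_closure_def)
  fix z :: 'a
  interpret algebraic_closure "ring_of_type_algebra :: 'a ring" K
    using local_field by (simp add: local_field_with_closure_def)
  show "\<exists>u. u ^ p = z"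
    using ex_root_binomial[of p z] \<open>prime p\<close> prime_gt_0_nat[of p]
    unfolding ring_of_type_algebra_pow by (auto simp: ring_of_type_algebra_def)
qed

lemma K_one: "1 \<in> K"
  and K_diff: "a \<in> K \<Longrightarrow> b \<in> K \<Longrightarrow> a - b \<in> K"
  and K_mult: "a \<in> K \<Longrightarrow> b \<in> K \<Longrightarrow> a * b \<in> K"
proof -
  interpret algebraic_closure "ring_of_type_algebra :: 'a ring" K
    using local_field by (simp add: local_field_with_closure_def)
  have minus: "\<ominus>\<^bsub>ring_of_type_algebra\<^esub> b = - b" for b :: 'a
    by (rule minus_equality) (auto simp: ring_of_type_algebra_def)
  note K = subringE[OF subfieldE(1)[OF subfield_axioms]]
  show "1 \<in> K" using K(3) by (simp add: ring_of_type_algebra_def)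
  show "a * b \<in> K" if "a \<in> K" "b \<in> K"
    using K(6)[OF that] by (simp add: ring_of_type_algebra_def)
  show "a - b \<in> K" if "a \<in> K" "b \<in> K"
    using K(7)[OF that(1) K(5)[OF that(2)]] unfolding minus by (simp add: ring_of_type_algebra_def)
qed

lemma K_power: "a \<in> K \<Longrightarrow> a ^ n \<in> K"
  by (induction n) (auto simp: K_one K_mult)

lemma K_subset_perfection: "K \<subseteq> perfection p K"
  unfolding perfection_def by (auto intro: exI[of _ 0])

lemma perfectionE:
  assumes "a \<in> perfection p K"
  obtains n where "\<And>m. m \<ge> n \<Longrightarrow> a ^ (p ^ m) \<in> K"
proof -
  obtain n where n: "a ^ (p ^ n) \<in> K" using assms by (auto simp: perfection_def)
  show ?thesis
  proof (rule that)
    fix m assume "m \<ge> n"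
    hence "a ^ (p ^ m) = (a ^ (p ^ n)) ^ (p ^ (m - n))"
      by (simp flip: power_mult power_add)
    thus "a ^ (p ^ m) \<in> K" using K_power[OF n] by simp
  qed
qed

lemma frobenius_quotient_perfection:
  assumes "N = max_ideal v (perfection p K) \<or> N = val_ring v (perfection p K)"
  shows "frobenius_quotient p v (perfection p K) N"
proof unfold_locales
  show "1 \<in> perfection p K" using K_one K_subset_perfection by blast
next
  fix a b assume "a \<in> perfection p K" "b \<in> perfection p K"
  then obtain n m where nm: "\<And>k. k \<ge> n \<Longrightarrow> a ^ (p ^ k) \<in> K" "\<And>k. k \<ge> m \<Longrightarrow> b ^ (p ^ k) \<in> K"
    using perfectionE by metis
  have "(a - b) ^ (p ^ (n + m)) = a ^ (p ^ (n + m)) - b ^ (p ^ (n + m))"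
    using frob_diff[of "int (n + m)" a b] by (simp add: frob_def nat_add_distrib)
  thus "a - b \<in> perfection p K" "a * b \<in> perfection p K"
    using nm(1)[of "n + m"] nm(2)[of "n + m"] K_diff K_mult
    by (auto simp: perfection_def power_mult_distrib intro!: exI[of _ "n + m"])
next
  fix a j assume "a \<in> perfection p K"
  then obtain n where n: "\<And>k. k \<ge> n \<Longrightarrow> a ^ (p ^ k) \<in> K" using perfectionE by blast
  have "frob p j a ^ (p ^ (n + nat (- j))) = a ^ (p ^ nat (int (n + nat (- j)) + j))"
    by (rule frob_power) simp
  also have "\<dots> \<in> K" by (rule n) linarith
  finally show "frob p j a \<in> perfection p K" by (auto simp: perfection_def)
qed (rule assms)

lemma frobenius_quotient_closure: "frobenius_quotient p v UNIV (max_ideal v UNIV)"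
  by unfold_locales auto

text \<open>Discreteness of \<open>v\<close> on \<open>K\<close> is the source of the uniform bound on the coefficients of \<open>x\<close>.\<close>

lemma discrete:
  assumes "a \<in> K" "v a > 0"
  shows "v a \<ge> 1"
proof (cases "a = 0")
  case False
  hence "v a \<in> range (\<lambda>n::int. ereal (of_int n))"
    using assms(1) local_field by (auto simp: local_field_with_closure_def normalized_on_def)
  thus ?thesis using assms(2) by (auto simp: one_ereal_def)
qed (simp add: valuation_zero[OF val])

lemma val_ring_K_cring: "cring (subset_ring (val_ring v K))"
  by (intro valuation_ring_cring val K_one K_diff K_mult)

lemma max_ideal_K: "ideal (max_ideal v K) (subset_ring (val_ring v K))"
proof (rule idealI)
  show "ring (subset_ring (val_ring v K))" using val_ring_K_cring cring.axioms(1) by blast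
  have "additive_subgroup (max_ideal v K) (subset_ring (val_ring v K))"
  proof (rule additive_subgroup_subset_ring[OF val_ring_K_cring])
    show "0 \<in> max_ideal v K"
      using K_diff[OF K_one K_one] by (simp add: max_ideal_def valuation_zero[OF val])
    show "a - b \<in> max_ideal v K" if "a \<in> max_ideal v K" "b \<in> max_ideal v K" for a b
      using that K_diff valuation_add_gt[OF val, of 0 a "- b"]
      by (simp add: max_ideal_def valuation_uminus[OF val])
  qed (auto simp: max_ideal_def val_ring_def)
  thus "subgroup (max_ideal v K) (add_monoid (subset_ring (val_ring v K)))"
    by (rule additive_subgroup.a_subgroup)
qed (auto simp: ring_of_type_algebra_def max_ideal_def val_ring_def K_mult valuation_mult[OF val]
    intro: add_pos_nonneg add_nonneg_pos)

lemma section_hom: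
  fixes s
  assumes s: "ring_section v K s"
  defines "h \<equiv> \<lambda>a. s (max_ideal v K +>\<^bsub>subset_ring (val_ring v K)\<^esub> a)"
  shows "h \<in> ring_hom (subset_ring (val_ring v K)) (subset_ring (val_ring v K))"
proof -
  have "s \<in> ring_hom (subset_ring (val_ring v K) Quot max_ideal v K) (subset_ring (val_ring v K))"
    using s by (simp add: ring_section_def residue_field_def)
  from ring_hom_trans[OF ideal.rcos_ring_hom[OF max_ideal_K] this] show ?thesis
    by (simp add: h_def comp_def)
qed

text \<open>For polynomials the twist involves only powers with natural exponents, which every ring
  homomorphism preserves.\<close>

lemma twisted_mult_hom:
  assumes h: "h \<in> ring_hom (subset_ring (val_ring v K)) (subset_ring (val_ring v K))"
    and f: "\<And>i. f i \<in> val_ring v K" "\<forall>i<0. f i = 0" "\<forall>i>m. f i = 0"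
    and g: "\<And>i. g i \<in> val_ring v K" "\<forall>i>m'. g i = 0"
  shows "h (twisted_mult p f g n) = twisted_mult p (\<lambda>i. h (f i)) (\<lambda>i. h (g i)) n"
proof -
  let ?O = "val_ring v K"
  have add: "h (a + b) = h a + h b" and mult: "h (a * b) = h a * h b" if "a \<in> ?O" "b \<in> ?O" for a b
    using ring_hom_add[OF h] ring_hom_mult[OF h] that by (auto simp: ring_of_type_algebra_def)
  have one: "h 1 = 1" using ring_hom_one[OF h] by (simp add: ring_of_type_algebra_def)
  interpret O: cring "subset_ring ?O" by (rule val_ring_K_cring)
  have O: "0 \<in> ?O" "1 \<in> ?O" "a \<in> ?O \<Longrightarrow> b \<in> ?O \<Longrightarrow> a + b \<in> ?O" "a \<in> ?O \<Longrightarrow> b \<in> ?O \<Longrightarrow> a * b \<in> ?O"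
    for a b
    using O.zero_closed O.one_closed O.a_closed[of a b] O.m_closed[of a b]
    by (simp_all add: ring_of_type_algebra_def)
  have zero: "h 0 = 0" using add[OF O(1) O(1)] by (metis add.right_neutral add_left_cancel)
  have power_O: "a ^ k \<in> ?O" if "a \<in> ?O" for a k
    using that O by (induction k) auto
  have power: "h (a ^ k) = h a ^ k" if "a \<in> ?O" for a k
    using that by (induction k) (auto simp: one mult power_O)
  have sum: "(\<Sum>i\<in>I. c i) \<in> ?O \<and> h (\<Sum>i\<in>I. c i) = (\<Sum>i\<in>I. h (c i))" if "\<And>i. i \<in> I \<Longrightarrow> c i \<in> ?O"
    for I :: "int set" and c
    using that by (induction I rule: infinite_finite_induct) (auto simp: zero add O)
  define S where "S = {i. f i \<noteq> 0 \<and> g (n - i) \<noteq> 0}"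
  have S: "finite S" unfolding S_def using f(3) g(2) by (rule finite_twisted_mult_support)
  have pos: "i \<ge> 0" if "i \<in> S" for i using that f(2) by (auto simp: S_def not_less[symmetric])
  have "h (twisted_mult p f g n) = (\<Sum>i\<in>S. h (f i * frob p i (g (n - i))))"
    unfolding twisted_mult_def S_def[symmetric]
    by (rule sum[THEN conjunct2]) (use pos f g power_O O in \<open>auto simp: frob_def\<close>)
  also have "\<dots> = (\<Sum>i\<in>S. h (f i) * frob p i (h (g (n - i))))"
    by (rule sum.cong) (use pos f g power_O in \<open>auto simp: frob_def mult power\<close>)
  also have "\<dots> = twisted_mult p (\<lambda>i. h (f i)) (\<lambda>i. h (g i)) n"
    by (rule twisted_mult_eq_sum[OF S, symmetric]) (auto simp: S_def zero intro: ccontr)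
  finally show ?thesis .
qed

lemma reduction_ring_hom:
  assumes s: "ring_section v K s" and \<psi>: "\<psi> \<in> ring_hom A (twisted_poly p (val_ring v K))"
  shows "reduction v K s \<psi> \<in> ring_hom A (twisted_poly p (val_ring v K))"
proof -
  let ?O = "val_ring v K"
  define h where "h = (\<lambda>a. s (max_ideal v K +>\<^bsub>subset_ring ?O\<^esub> a))"
  have h: "h \<in> ring_hom (subset_ring ?O) (subset_ring ?O)"
    unfolding h_def by (rule section_hom[OF s])
  have O: "ring (subset_ring ?O)" using val_ring_K_cring by (rule cring.axioms(1))
  have h_O: "h a \<in> ?O" if "a \<in> ?O" for a
    using ring_hom_closed[OF h] that by simp
  have h_zero: "h 0 = 0"
    using ring_hom_zero[OF h O O] by (simp add: ring_of_type_algebra_def)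
  have h_one: "h 1 = 1"
    using ring_hom_one[OF h] by (simp add: ring_of_type_algebra_def)
  have h_add: "h (a + b) = h a + h b" if "a \<in> ?O" "b \<in> ?O" for a b
    using ring_hom_add[OF h] that by (simp add: ring_of_type_algebra_def)
  have coeff: "\<psi> a i \<in> ?O" and neg: "\<forall>i<0. \<psi> a i = 0" and bdd: "\<exists>m. \<forall>i>m. \<psi> a i = 0"
    if a: "a \<in> carrier A" for a i
  proof -
    note * = twisted_poly_homD(1)[OF \<psi> a, unfolded carrier_twisted_poly]
    show "\<psi> a i \<in> ?O" by (rule *[THEN conjunct1, THEN spec])
    show "\<forall>i<0. \<psi> a i = 0" by (rule *[THEN conjunct2, THEN conjunct1])
    show "\<exists>m. \<forall>i>m. \<psi> a i = 0" by (rule *[THEN conjunct2, THEN conjunct2])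
  qed
  have mult: "twisted_mult p (\<lambda>i. h (\<psi> a i)) (\<lambda>i. h (\<psi> b i)) i = h (twisted_mult p (\<psi> a) (\<psi> b) i)"
    if ab: "a \<in> carrier A" "b \<in> carrier A" for a b i
  proof -
    obtain m where "\<forall>i>m. \<psi> a i = 0" using bdd[OF ab(1)] ..
    moreover obtain m' where "\<forall>i>m'. \<psi> b i = 0" using bdd[OF ab(2)] ..
    ultimately show ?thesis
      using twisted_mult_hom[OF h, of "\<psi> a" m "\<psi> b" m' i] coeff[OF ab(1)] coeff[OF ab(2)] neg[OF ab(1)]
      by simp
  qed
  have "reduction v K s \<psi> = (\<lambda>a i. h (\<psi> a i))"
    by (simp add: reduction_def h_def)
  moreover have "(\<lambda>a i. h (\<psi> a i)) \<in> ring_hom A (twisted_poly p ?O)"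
  proof (rule ring_hom_memI)
    fix a assume a: "a \<in> carrier A"
    obtain m where "\<forall>i>m. \<psi> a i = 0" using bdd[OF a] ..
    hence "\<forall>i>m. h (\<psi> a i) = 0" using h_zero by simp
    thus "(\<lambda>i. h (\<psi> a i)) \<in> carrier (twisted_poly p ?O)"
      using neg[OF a] coeff[OF a] h_O h_zero by (auto simp: carrier_twisted_poly)
  next
    fix a b assume ab: "a \<in> carrier A" "b \<in> carrier A"
    show "(\<lambda>i. h (\<psi> (a \<otimes>\<^bsub>A\<^esub> b) i)) =
        (\<lambda>i. h (\<psi> a i)) \<otimes>\<^bsub>twisted_poly p ?O\<^esub> (\<lambda>i. h (\<psi> b i))"
      using mult[OF ab] twisted_poly_homD(5)[OF \<psi> ab]
      by (simp add: twisted_poly_def twisted_laurent_def fun_eq_iff)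
    show "(\<lambda>i. h (\<psi> (a \<oplus>\<^bsub>A\<^esub> b) i)) =
        (\<lambda>i. h (\<psi> a i)) \<oplus>\<^bsub>twisted_poly p ?O\<^esub> (\<lambda>i. h (\<psi> b i))"
      using h_add[OF coeff[OF ab(1)] coeff[OF ab(2)]] twisted_poly_homD(4)[OF \<psi> ab]
      by (simp add: twisted_poly_def twisted_laurent_def)
  next
    show "(\<lambda>i. h (\<psi> \<one>\<^bsub>A\<^esub> i)) = \<one>\<^bsub>twisted_poly p ?O\<^esub>"
      using twisted_poly_homD(3)[OF \<psi>] h_zero h_one
      by (auto simp: twisted_poly_def twisted_laurent_def)
  qed
  ultimately show ?thesis by simp
qed

end

section \<open>The isomorphisms\<close>

theorem proposition9p4:
  fixes p :: nat
    and K :: "'a::field set"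
    and v :: "'a \<Rightarrow> ereal"
    and s :: "'a set \<Rightarrow> 'a"
    and winf :: "'f::field \<Rightarrow> ereal"
    and A :: "'f ring"
    and \<psi> \<phi> :: "'f \<Rightarrow> int \<Rightarrow> 'a"
    and x y :: "int \<Rightarrow> 'a"
  assumes local_field: "local_field_with_closure p K v"
    and lift: "ring_section v K s"
    and coefficient_ring: "global_function_field p TYPE('f)" "place winf" "A = regular_outside winf"
    and drinfeld: "good_reduction_drinfeld p A (val_ring v K) \<psi>"
    and reduction: "\<phi> = reduction v K s \<psi>"
    and x_integral: "\<forall>j. x j \<in> val_ring v K" "\<forall>j>0. x j = 0"
    and x_cong_1: "x 0 - 1 \<in> max_ideal v K" "\<forall>j<0. x j \<in> max_ideal v K"
    and x_intertwines: "\<forall>a\<in>carrier A.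
          \<psi> a \<otimes>\<^bsub>twisted_laurent p (perfection p K)\<^esub> x = x \<otimes>\<^bsub>twisted_laurent p (perfection p K)\<^esub> \<phi> a"
    and y_inverse: "y \<in> carrier (twisted_power_series p (val_ring v (perfection p K)))"
      "x \<otimes>\<^bsub>twisted_power_series p (val_ring v (perfection p K))\<^esub> y =
         \<one>\<^bsub>twisted_power_series p (val_ring v (perfection p K))\<^esub>"
      "y \<otimes>\<^bsub>twisted_power_series p (val_ring v (perfection p K))\<^esub> x =
         \<one>\<^bsub>twisted_power_series p (val_ring v (perfection p K))\<^esub>"
  shows
    "(\<exists>\<chi>. series_module_iso p A UNIV (max_ideal v UNIV) \<phi> \<psi> x y \<chi>) \<and>
     (\<exists>\<chi>. series_module_iso p A (perfection p K) (max_ideal v (perfection p K)) \<phi> \<psi> x y \<chi>) \<and>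
     (\<exists>\<chi>. series_module_iso p A (perfection p K) (val_ring v (perfection p K)) \<phi> \<psi> x y \<chi>)"
proof -
  interpret local_field p K v by (rule local_field.intro[OF local_field])
  let ?O = "val_ring v K" and ?P = "perfection p K"
  have A: "cring A" unfolding coefficient_ring(3) by (rule regular_outside_cring)
  have O_sub: "?O \<subseteq> ?P" using K_subset_perfection by (auto simp: val_ring_def)
  have O_val: "v a \<ge> 0" if "a \<in> ?O" for a using that by (simp add: val_ring_def)
  have m_val: "v a \<ge> 1" if "a \<in> max_ideal v K" for a
    using that discrete by (simp add: max_ideal_def)

  have \<psi>_hom: "\<psi> \<in> ring_hom A (twisted_poly p ?O)"
    using drinfeld by (simp add: good_reduction_drinfeld_def)
  have \<phi>_hom: "\<phi> \<in> ring_hom A (twisted_poly p ?O)"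
    unfolding reduction by (rule reduction_ring_hom[OF lift \<psi>_hom])

  have x_small: "\<forall>j<0. v (x j) \<ge> ereal 1" "v (x 0 - 1) \<ge> ereal 1"
    using x_cong_1 m_val by (simp_all add: one_ereal_def[symmetric])
  have x_contr: "contracting ?P x"
    unfolding contracting_def using x_integral x_small(1) O_sub O_val
    by (auto intro: exI[of _ 0] exI[of _ 1])
  have y: "\<forall>j. y j \<in> val_ring v ?P" "\<forall>j>0. y j = 0"
    using y_inverse(1) by (simp_all add: twisted_power_series_def)
  have xy: "twisted_mult p x y = (\<lambda>i. if i = 0 then 1 else 0)"
    and yx: "twisted_mult p y x = (\<lambda>i. if i = 0 then 1 else 0)"
    using y_inverse(2,3) by (simp_all add: twisted_power_series_def twisted_laurent_def)
  have y_val: "\<forall>j. v (y j) \<ge> 0" using y(1) by (simp add: val_ring_def)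
  have y_contr: "contracting ?P y"
    unfolding contracting_def
    using y y_val inverse_coeff_bound[OF x_integral(2) x_small(2,1) y(2) y_val xy]
    by (auto simp: val_ring_def intro: exI[of _ 0] exI[of _ 1])
  have comm: "twisted_mult p (\<psi> a) x = twisted_mult p x (\<phi> a)" if "a \<in> carrier A" for a
    using x_intertwines that by (simp add: twisted_laurent_def)

  have iso: "\<exists>\<chi>. series_module_iso p A H N \<phi> \<psi> x y \<chi>"
    if "frobenius_quotient p v H N" and H: "?P \<subseteq> H" for H N
  proof -
    interpret frobenius_quotient p v H N by (rule that)
    have contr: "contracting H f" if "contracting ?P f" for f
      using contracting_mono that H by blast
    have "?O \<subseteq> val_ring v H" using O_sub H by (auto simp: val_ring_def)
    hence "\<phi> \<in> ring_hom A (twisted_poly p (val_ring v H))"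
        "\<psi> \<in> ring_hom A (twisted_poly p (val_ring v H))"
      using twisted_poly_hom_mono[OF \<phi>_hom] twisted_poly_hom_mono[OF \<psi>_hom] by simp_all
    from series_module_iso_action[of A \<phi> \<psi>, OF A this contr[OF x_contr] x_integral(2)
        contr[OF y_contr] y(2) xy yx comm]
    show ?thesis by blast
  qed
  show ?thesis
    using iso[OF frobenius_quotient_closure]
      iso[OF frobenius_quotient_perfection[OF disjI1[OF refl]]]
      iso[OF frobenius_quotient_perfection[OF disjI2[OF refl]]] by blast
qed

end
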